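(* Suppose that $X\in\mathcal{M}_\infty$, let $\mathfrak{o}$ be the fixed reference point, and let $0<q<1$. (1) For $x\in E$ set $H_q(x)=K_q\delta_{\mathfrak{r}}(x)$ (resp. $\widehat H_q(x)=\widehat K_q\delta_{\mathfrak{l}}(x)$). Then $H_q\in\mathcal{E}_q^{min}$ (resp. $\widehat H_q\in\widehat{\mathcal{E}}_q^{min}$), and it is the unique minimal increasing (resp. decreasing) $q$-excessive function for $P$ (resp. $\widehat P$) such that $H_q(\mathfrak{o})=1$ (resp. $\widehat H_q(\mathfrak{o})=1$). Moreover, if $X\in\mathcal{M}_\infty$ then $H_q$ is the unique increasing function in $\mathcal{H}_q$ (with value $1$ at $\mathfrak{o}$); and if, instead, $X\in\mathcal{M}\setminus\mathcal{M}_\infty$, then the function $H_q$ defined in the same way satisfies $H_q\in\mathcal{P}_q$ with $H_q(\mathfrak{r})<\infty$. (2) For any $y\in E$ with $y<\mathfrak{r}$, the limit $\kappa_q^{y]}=\lim_{x\to\mathfrak{r}}\frac{K_q\delta_{\mathfrak{r}}(x)}{K_q^{y]}\delta_{\mathfrak{r}}(x)}$ exists and $0<\kappa_q^{y]}<\infty$. The function $\mathbf{H}_q^{y]}$ defined, for $x\in E^{y]}$, by $\mathbf{H}_q^{y]}(x)=\kappa_q^{y]}K_q^{y]}\delta_{\mathfrak{r}}(x)$ has, with respect to $P^{y]}$, the same property as $H_q$ has with respect to $P$ in (1), but with the normalization at $\mathfrak{o}$ replaced by $\lim_{x\to\mathfrak{r}}\frac{\mathbf{H}_q^{y]}(x)}{H_q(x)}=1$.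 (By convention $\mathbf{H}_q^{y]}(x)=0$ for $x\le y$.) (3) Set $C_q=G_q(\mathfrak{o},\mathfrak{o})>0$. Then, for all $x,y\in E$, $$G_q(x,y)=C_q\,\widehat H_q(y)\left(H_q(x)-\mathbf{H}_q^{y]}(x)\right).$$
   Context: $E\subseteq\mathbb{Z}$ is a countable interval of integers with left endpoint $\mathfrak{l}$ and right endpoint $\mathfrak{r}$ (possibly infinite), each of which may or may not belong to $E$. $X=(X_n)_{n\ge0}$ is a Markov chain on $E$ with transition matrix $P=(p(x,y))_{x,y\in E}$ (possibly substochastic, i.e. the chain may have a finite lifetime). $\mathcal{M}$ is the set of such chains that are irreducible (for all $x,y$ with $\mathfrak{l}<x,y<\mathfrak{r}$, $p^{(n)}(x,y)=\mathbb{P}_x(X_n=y)>0$ for some $n$) and upward skip-free: $p(x,x+1)>0$ and $p(x,x+y)=0$ for $y\ge2$. Convention: $\mathfrak{r}\in E$ if the boundary point $\mathfrak{r}$ is not absorbing; if $\mathfrak{r}$ is absorbing or $\mathfrak{r}=\infty$ (so $\mathfrak{r}\notin E$), one writes $X\in\mathcal{M}_\infty$. $\pi$ is a fixed positive finite-valued excessive measure ($\pi P\le\pi$), the reference measure. For $0<q<1$, $G_q(x,y)=\sum_{n\ge0}q^n\frac{p^{(n)}(x,y)}{\pi(y)}$. The dual matrix $\widehat P$ is $\widehat p(y,x)\pi(y)=p(x,y)\pi(x)$, and $\widehat G_q$ is defined from $\widehat P$ in the same way. A reference point $\mathfrak{o}\in E$, $\mathfrak{o}<\mathfrak{r}-1$,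 is fixed, and $K_q(x,y)=\frac{G_q(x,y)}{G_q(\mathfrak{o},y)}$, $\widehat K_q(x,y)=\frac{\widehat G_q(x,y)}{\widehat G_q(\mathfrak{o},y)}$ are the $q$-Martin kernels. $K_q\delta_y(x)=K_q(x,y)$; at the endpoints the kernels are extended by limits: $K_q\delta_{\mathfrak{r}}(x)=\lim_{y\to\mathfrak{r}}K_q(x,y)$ (which is $K_q(x,\mathfrak{r})$ if $\mathfrak{r}\in E$) and $\widehat K_q\delta_{\mathfrak{l}}(x)=\lim_{y\to\mathfrak{l}}\widehat K_q(x,y)$. For $y\in E$, $E^{y]}=\{x\in E: x>y\}$ and $P^{y]}$ is the restriction of $P$ to $E^{y]}$, i.e. the transition matrix of $X$ killed upon entering $\{x\in E:x\le y\}$. $G^{y]}_q$ is its $q$-potential kernel with respect to $\pi$, and $K_q^{y]}(x,z)=G_q^{y]}(x,z)/G_q^{y]}(\mathfrak{o}^{y]},z)$ its Martin kernel for a chosen reference point $\mathfrak{o}^{y]}\in E^{y]}$; $K_q^{y]}\delta_{\mathfrak{r}}$ is its limit as $z\to\mathfrak{r}$. A non-negative function $f$ is $q$-excessive if $qPf\le f$, $q$-harmonic if $qPf=f$, and a $q$-potential if it is $q$-excessive and $(qP)^nf\to0$ pointwise; $\mathcal{E}_q,\mathcal{H}_q,\mathcal{P}_q$ denote the corresponding sets. A non-zero $f\in\mathcal{E}_q$ is minimal if $f=f_1+f_2$ with $f_1,f_2\in\mathcal{E}_q$ implies that $f_1,f_2$ are proportional to $f$; $\mathcal{E}_q^{min}$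 is the set of minimal $q$-excessive functions. Hats denote the same notions for $\widehat P$.
   Formalization: If r is finite and absorbing, no non-zero q-harmonic function need exist on E and (3) can fail; so r is added as an absorbing state with p(r-1,r)>0, functions carry a boundary value at r (excessivity and harmonicity are required on E only), and limits as x tends to r are values at r. *)

theory Defs
  imports "HOL-Analysis.Analysis" "HOL-Library.Extended"
begin

text \<open>
  Chains are represented by their transition matrices, and all kernels and functions take values
  in \<open>ennreal\<close>; only their values on the relevant state space matter.

  The endpoints of the interval \<open>E\<close> of integers are extended integers.  An absorbing finite right
  endpoint \<open>r\<close> is not an element of \<open>E\<close>, but the chain does jump from \<open>r - 1\<close> to \<open>r\<close>, so
  transition matrices, kernels and functions also live on \<open>with_right_end E r\<close>, the set \<open>E\<close>
  together with \<open>r\<close> if \<open>r\<close> is finite.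
\<close>

definition with_right_end :: "int set \<Rightarrow> int extended \<Rightarrow> int set" where
  "with_right_end E r = E \<union> {a. Fin a = r}"

definition is_interval_between :: "int extended \<Rightarrow> int extended \<Rightarrow> int set \<Rightarrow> bool" where
  "is_interval_between l r E \<longleftrightarrow>
     {x. l < Fin x \<and> Fin x < r} \<subseteq> E \<and> E \<subseteq> {x. l \<le> Fin x \<and> Fin x \<le> r}"

fun transition_power :: "int set \<Rightarrow> (int \<Rightarrow> int \<Rightarrow> ennreal) \<Rightarrow> nat \<Rightarrow> int \<Rightarrow> int \<Rightarrow> ennreal" where
  "transition_power S p 0 x y = (if x = y then 1 else 0)"
| "transition_power S p (Suc n) x y = (\<integral>\<^sup>+ z. p x z * transition_power S p n z y \<partial>count_space S)"

definition substochastic :: "int set \<Rightarrow> (int \<Rightarrow> int \<Rightarrow> ennreal) \<Rightarrow> bool" where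
  "substochastic S p \<longleftrightarrow> (\<forall>x\<in>S. (\<integral>\<^sup>+ y. p x y \<partial>count_space S) \<le> 1)"

text \<open>The class \<open>\<M>\<close>.  A finite endpoint \<open>r\<close> belongs to \<open>E\<close> iff it is not absorbing.\<close>

definition skip_free_chain ::
    "int extended \<Rightarrow> int extended \<Rightarrow> int set \<Rightarrow> (int \<Rightarrow> int \<Rightarrow> ennreal) \<Rightarrow> bool" where
  "skip_free_chain l r E p \<longleftrightarrow>
     (let S = with_right_end E r in
        is_interval_between l r E \<and>
        (\<forall>a. Fin a = r \<longrightarrow> (a \<in> E \<longleftrightarrow> p a a \<noteq> 1)) \<and>
        substochastic S p \<and>
        (\<forall>x y. l < Fin x \<and> Fin x < r \<and> l < Fin y \<and> Fin y < r \<longrightarrow>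
           (\<exists>n. transition_power S p n x y > 0)) \<and>
        (\<forall>x\<in>S. x + 1 \<in> S \<longrightarrow> p x (x + 1) > 0) \<and>
        (\<forall>x\<in>S. \<forall>k\<ge>2. x + k \<in> S \<longrightarrow> p x (x + k) = 0))"

text \<open>The class \<open>\<M>\<^sub>\<infinity>\<close>.\<close>

definition skip_free_chain_inf ::
    "int extended \<Rightarrow> int extended \<Rightarrow> int set \<Rightarrow> (int \<Rightarrow> int \<Rightarrow> ennreal) \<Rightarrow> bool" where
  "skip_free_chain_inf l r E p \<longleftrightarrow> skip_free_chain l r E p \<and> (\<forall>a. Fin a = r \<longrightarrow> a \<notin> E)"

text \<open>
  At an absorbing \<open>r\<close>, which is outside \<open>E\<close>, the value of \<open>\<pi>\<close> is only a positive normalisation of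
  the column \<open>r\<close> of the potential kernel; it cancels in the Martin kernel.
\<close>

definition reference_measure ::
    "int extended \<Rightarrow> int set \<Rightarrow> (int \<Rightarrow> int \<Rightarrow> ennreal) \<Rightarrow> (int \<Rightarrow> ennreal) \<Rightarrow> bool" where
  "reference_measure r E p \<pi> \<longleftrightarrow>
     (\<forall>x\<in>with_right_end E r. 0 < \<pi> x \<and> \<pi> x < top) \<and>
     (\<forall>y\<in>E. (\<integral>\<^sup>+ x. \<pi> x * p x y \<partial>count_space E) \<le> \<pi> y)"

definition dual_matrix ::
    "(int \<Rightarrow> int \<Rightarrow> ennreal) \<Rightarrow> (int \<Rightarrow> ennreal) \<Rightarrow> int \<Rightarrow> int \<Rightarrow> ennreal" where
  "dual_matrix p \<pi> y x = p x y * \<pi> x / \<pi> y"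

definition potential_kernel ::
    "int set \<Rightarrow> (int \<Rightarrow> int \<Rightarrow> ennreal) \<Rightarrow> (int \<Rightarrow> ennreal) \<Rightarrow> ennreal \<Rightarrow> int \<Rightarrow> int \<Rightarrow> ennreal" where
  "potential_kernel S p \<pi> q x y = (\<Sum>n. q ^ n * (transition_power S p n x y / \<pi> y))"

definition martin_kernel ::
    "int set \<Rightarrow> (int \<Rightarrow> int \<Rightarrow> ennreal) \<Rightarrow> (int \<Rightarrow> ennreal) \<Rightarrow> ennreal \<Rightarrow> int
      \<Rightarrow> int \<Rightarrow> int \<Rightarrow> ennreal" where
  "martin_kernel S p \<pi> q ref x y =
     potential_kernel S p \<pi> q x y / potential_kernel S p \<pi> q ref y"

text \<open>
  Approaching the right or left end of a set of integers from within the set.  If the set has a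
  greatest (least) element, the limit along this filter is the value at that element; otherwise
  it is the limit at \<open>\<infinity>\<close> (\<open>-\<infinity>\<close>).
\<close>

definition to_right_end :: "int set \<Rightarrow> int filter" where
  "to_right_end S = (INF z\<in>S. principal {y\<in>S. z \<le> y})"

definition to_left_end :: "int set \<Rightarrow> int filter" where
  "to_left_end S = (INF z\<in>S. principal {y\<in>S. y \<le> z})"

definition martin_right ::
    "int set \<Rightarrow> (int \<Rightarrow> int \<Rightarrow> ennreal) \<Rightarrow> (int \<Rightarrow> ennreal) \<Rightarrow> ennreal \<Rightarrow> int
      \<Rightarrow> int \<Rightarrow> ennreal" where
  "martin_right S p \<pi> q ref x = Lim (to_right_end S) (martin_kernel S p \<pi> q ref x)"

definition martin_left ::
    "int set \<Rightarrow> (int \<Rightarrow> int \<Rightarrow> ennreal) \<Rightarrow> (int \<Rightarrow> ennreal) \<Rightarrow> ennreal \<Rightarrow> int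
      \<Rightarrow> int \<Rightarrow> ennreal" where
  "martin_left S p \<pi> q ref x = Lim (to_left_end S) (martin_kernel S p \<pi> q ref x)"

definition discounted_op ::
    "ennreal \<Rightarrow> int set \<Rightarrow> (int \<Rightarrow> int \<Rightarrow> ennreal) \<Rightarrow> (int \<Rightarrow> ennreal) \<Rightarrow> int \<Rightarrow> ennreal" where
  "discounted_op q S p f x = q * (\<integral>\<^sup>+ z. p x z * f z \<partial>count_space S)"

text \<open>
  In the following notions functions live on \<open>S\<close> and the conditions on \<open>q P f\<close> are imposed at the
  states of \<open>E \<subseteq> S\<close>.  We use \<open>S = E\<close> or, with an absorbing right endpoint, \<open>S = E \<union> {r}\<close>; no
  condition is imposed at \<open>r\<close>, so that there \<open>f r\<close> is a boundary value.
\<close>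

definition q_excessive ::
    "ennreal \<Rightarrow> int set \<Rightarrow> int set \<Rightarrow> (int \<Rightarrow> int \<Rightarrow> ennreal) \<Rightarrow> (int \<Rightarrow> ennreal) set" where
  "q_excessive q E S p =
     {f. (\<forall>x\<in>S. f x < top) \<and> (\<forall>x\<in>E. discounted_op q S p f x \<le> f x)}"

definition q_harmonic ::
    "ennreal \<Rightarrow> int set \<Rightarrow> int set \<Rightarrow> (int \<Rightarrow> int \<Rightarrow> ennreal) \<Rightarrow> (int \<Rightarrow> ennreal) set" where
  "q_harmonic q E S p =
     {f. (\<forall>x\<in>S. f x < top) \<and> (\<forall>x\<in>E. discounted_op q S p f x = f x)}"

definition q_potential ::
    "ennreal \<Rightarrow> int set \<Rightarrow> int set \<Rightarrow> (int \<Rightarrow> int \<Rightarrow> ennreal) \<Rightarrow> (int \<Rightarrow> ennreal) set" where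
  "q_potential q E S p =
     {f \<in> q_excessive q E S p. \<forall>x\<in>E. (\<lambda>n. (discounted_op q S p ^^ n) f x) \<longlonglongrightarrow> 0}"

definition minimal_q_excessive ::
    "ennreal \<Rightarrow> int set \<Rightarrow> int set \<Rightarrow> (int \<Rightarrow> int \<Rightarrow> ennreal) \<Rightarrow> (int \<Rightarrow> ennreal) set" where
  "minimal_q_excessive q E S p =
     {f \<in> q_excessive q E S p. (\<exists>x\<in>S. f x \<noteq> 0) \<and>
        (\<forall>f1\<in>q_excessive q E S p. \<forall>f2\<in>q_excessive q E S p.
           (\<forall>x\<in>S. f x = f1 x + f2 x) \<longrightarrow>
             (\<exists>c<top. \<forall>x\<in>S. f1 x = c * f x) \<and> (\<exists>c<top. \<forall>x\<in>S. f2 x = c * f x))}"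

definition unique_on :: "int set \<Rightarrow> ((int \<Rightarrow> ennreal) \<Rightarrow> bool) \<Rightarrow> (int \<Rightarrow> ennreal) \<Rightarrow> bool" where
  "unique_on S Q h \<longleftrightarrow> Q h \<and> (\<forall>f. Q f \<longrightarrow> (\<forall>x\<in>S. f x = h x))"

definition above :: "int set \<Rightarrow> int \<Rightarrow> int set" where
  "above S y = {x\<in>S. y < x}"

text \<open>
  The constant \<open>\<kappa>\<^sub>q\<^sup>y\<close> and the function \<open>\<^bold>H\<^sub>q\<^sup>y\<close> of the chain killed upon entering \<open>{x. x \<le> y}\<close>;
  \<open>ref\<close> is the reference point of the chain itself and \<open>ref'\<close> that of the killed chain.
\<close>

definition kappa_ratio ::
    "int set \<Rightarrow> (int \<Rightarrow> int \<Rightarrow> ennreal) \<Rightarrow> (int \<Rightarrow> ennreal) \<Rightarrow> ennreal \<Rightarrow> int \<Rightarrow> int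
      \<Rightarrow> int \<Rightarrow> int \<Rightarrow> ennreal" where
  "kappa_ratio S p \<pi> q ref ref' y x =
     martin_right S p \<pi> q ref x / martin_right (above S y) p \<pi> q ref' x"

definition kappa ::
    "int set \<Rightarrow> (int \<Rightarrow> int \<Rightarrow> ennreal) \<Rightarrow> (int \<Rightarrow> ennreal) \<Rightarrow> ennreal \<Rightarrow> int \<Rightarrow> int
      \<Rightarrow> int \<Rightarrow> ennreal" where
  "kappa S p \<pi> q ref ref' y =
     Lim (to_right_end (above S y)) (kappa_ratio S p \<pi> q ref ref' y)"

definition killed_H ::
    "int set \<Rightarrow> (int \<Rightarrow> int \<Rightarrow> ennreal) \<Rightarrow> (int \<Rightarrow> ennreal) \<Rightarrow> ennreal \<Rightarrow> int \<Rightarrow> int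
      \<Rightarrow> int \<Rightarrow> int \<Rightarrow> ennreal" where
  "killed_H S p \<pi> q ref ref' y x =
     (if x \<le> y then 0
      else kappa S p \<pi> q ref ref' y * martin_right (above S y) p \<pi> q ref' x)"

end

theory Submission
  imports Defs
begin

text \<open>
  Everything rests on one comparison principle: since \<open>q < 1\<close>, a bounded function that is
  \<open>q\<close>-subharmonic on a set \<open>D\<close> is dominated on \<open>D\<close> by every \<open>q\<close>-superharmonic function that
  dominates it at the states where the chain can leave \<open>D\<close> (\<open>comparison_principle\<close>).  So bounded
  harmonic functions are determined by their values at the exit states.  An upward skip-free chain
  that starts below \<open>y\<close> can leave \<open>{x. x < y}\<close> only through \<open>y\<close>, and an increasing function is bounded
  below \<open>y\<close> by its value there.

  Put \<open>\<phi>(x, y) = G\<^sub>q(x, y) / G\<^sub>q(y, y)\<close>, the expectation of \<open>q\<close> to the power of the first hitting time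
  of \<open>y\<close> from \<open>x\<close>.  As \<open>y\<close> is the only exit, \<open>\<phi>(x, z) = \<phi>(x, y) \<phi>(y, z)\<close> for \<open>x \<le> y \<le> z\<close>
  (\<open>hitting_mult\<close>).  Hence the Martin kernel \<open>\<phi>(x, y) / \<phi>(ref, y)\<close> does not depend on \<open>y\<close> as soon as
  \<open>y \<ge> x\<close> and \<open>y \<ge> ref\<close>, and the limit \<open>H\<close> is an eventually constant one.  An increasing function \<open>f\<close> that is
  harmonic below the top satisfies \<open>f(x) = \<phi>(x, y) f(y)\<close> for \<open>x \<le> y\<close>, which forces
  \<open>f = f(ref) H\<close> (\<open>increasing_harmonic_iff\<close>).  A minimal excessive function with a charge at \<open>y\<close> is a
  multiple of \<open>G\<^sub>q(\<cdot>, y)\<close>, which strictly drops from \<open>y\<close> to \<open>y + 1\<close>; so an increasing one carries no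
  charge below the top and is again a multiple of \<open>H\<close> (\<open>minimal_increasing_iff\<close>).

  The chain killed below a level is of the same type, and so is the dual chain after the reflection
  \<open>x \<mapsto> -x\<close>; the same results apply to both.  With \<open>K\<close> the function \<open>H\<close> of the chain killed at or
  below \<open>y\<close>, the ratio \<open>H / K\<close> is decreasing, because killing can only lower \<open>\<phi>\<close>, so it has a limit
  \<open>\<kappa>\<close>.  A path that reaches a high state only after a visit at or below \<open>y\<close> loses at least one
  factor \<open>q\<close>, which gives \<open>\<kappa> K \<le> H \<le> \<kappa> K + q H(y)\<close> (\<open>killed_le_full\<close>, \<open>full_le_killed\<close>).  The upper
  bound shows that \<open>\<kappa> > 0\<close>, since \<open>H\<close> increases, and also that \<open>H - \<kappa> K\<close> (with \<open>K = 0\<close> on \<open>{x. x \<le> y}\<close>)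
  is bounded.  This difference is harmonic off \<open>y\<close>, equals \<open>H(y)\<close> at \<open>y\<close> and vanishes at an absorbing
  right end; by comparison it is \<open>H(y) \<phi>(\<cdot>, y)\<close> (\<open>full_minus_killed\<close>).  Multiplying by
  \<open>G\<^sub>q(y, y) / H(y)\<close>, which is \<open>C\<^sub>q\<close> times the dual function at \<open>y\<close> (\<open>diagonal_factorization\<close>), yields the
  factorization of \<open>G\<^sub>q\<close>.
\<close>

section \<open>The discounted transition operator\<close>

lemma discounted_op_mono:
  assumes "\<And>z. z \<in> S \<Longrightarrow> p x z \<noteq> 0 \<Longrightarrow> f z \<le> g z"
  shows "discounted_op q S p f x \<le> discounted_op q S p g x"
  unfolding discounted_op_def
proof (rule mult_left_mono[OF nn_integral_mono])
  fix z assume "z \<in> space (count_space S)"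
  then show "p x z * f z \<le> p x z * g z"
    using assms[of z] by (cases "p x z = 0") (auto intro: mult_left_mono)
qed simp

lemma discounted_op_cong:
  assumes "\<And>z. z \<in> S \<Longrightarrow> p x z \<noteq> 0 \<Longrightarrow> f z = g z"
  shows "discounted_op q S p f x = discounted_op q S p g x"
  by (intro antisym discounted_op_mono) (simp_all add: assms)

lemma discounted_op_add:
  "discounted_op q S p (\<lambda>z. f z + g z) x = discounted_op q S p f x + discounted_op q S p g x"
  by (simp add: discounted_op_def distrib_left nn_integral_add)

lemma discounted_op_cmult:
  "discounted_op q S p (\<lambda>z. c * f z) x = c * discounted_op q S p f x"
  by (simp add: discounted_op_def mult.left_commute nn_integral_cmult)

lemma discounted_op_divide:
  "discounted_op q S p (\<lambda>z. f z / c) x = discounted_op q S p f x / c"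
  using discounted_op_cmult[of q S p "inverse c" f x]
  by (simp add: divide_ennreal_def mult.commute)

lemma discounted_op_const_le:
  assumes "substochastic S p" "x \<in> S"
  shows "discounted_op q S p (\<lambda>_. c) x \<le> q * c"
proof -
  have "(\<integral>\<^sup>+ z. p x z * c \<partial>count_space S) \<le> 1 * c"
    unfolding substochastic_def
    by (subst nn_integral_multc) (use assms in \<open>auto simp: substochastic_def intro!: mult_right_mono simp del: mult_1\<close>)
  then show ?thesis
    unfolding discounted_op_def by (auto intro: mult_left_mono)
qed

lemma discounted_op_le_bound:
  assumes "substochastic S p" "x \<in> S" "\<And>z. z \<in> S \<Longrightarrow> p x z \<noteq> 0 \<Longrightarrow> f z \<le> c"
  shows "discounted_op q S p f x \<le> q * c"
  using discounted_op_mono[of S p x f "\<lambda>_. c" q] discounted_op_const_le[OF assms(1,2)] assms(3)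
  by (meson order_trans)

lemma discounted_op_subset:
  assumes "T \<subseteq> S" "\<And>z. z \<in> S - T \<Longrightarrow> f z = 0"
  shows "discounted_op q S p f x = discounted_op q T p f x"
  unfolding discounted_op_def
  by (rule arg_cong[where f = "(*) q"], rule nn_integral_count_space_eq) (use assms in auto)

lemma discounted_op_subset_le:
  assumes "T \<subseteq> S"
  shows "discounted_op q T p f x \<le> discounted_op q S p f x"
proof -
  have "discounted_op q T p f x = discounted_op q T p (\<lambda>z. if z \<in> T then f z else 0) x"
    by (rule discounted_op_cong) simp
  also have "\<dots> = discounted_op q S p (\<lambda>z. if z \<in> T then f z else 0) x"
    using assms by (subst discounted_op_subset[of T S]) auto
  also have "\<dots> \<le> discounted_op q S p f x"
    by (rule discounted_op_mono) auto
  finally show ?thesis .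
qed

lemma discounted_op_ge_summand:
  assumes "z \<in> S"
  shows "q * (p x z * f z) \<le> discounted_op q S p f x"
  using discounted_op_subset_le[of "{z}" S q p f x] assms
  by (simp add: discounted_op_def nn_integral_count_space_finite)

lemma substochastic_subset:
  assumes "substochastic S p" "T \<subseteq> S"
  shows "substochastic T p"
  unfolding substochastic_def
proof
  fix x assume "x \<in> T"
  have "(\<integral>\<^sup>+ y. p x y \<partial>count_space T) \<le> (\<integral>\<^sup>+ y. p x y \<partial>count_space S)"
    using discounted_op_subset_le[OF assms(2), of 1 p "\<lambda>_. 1" x] by (simp add: discounted_op_def)
  also have "\<dots> \<le> 1"
    using assms \<open>x \<in> T\<close> by (auto simp: substochastic_def)
  finally show "(\<integral>\<^sup>+ y. p x y \<partial>count_space T) \<le> 1" .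
qed

lemma suminf_power_ennreal_less_top:
  fixes q :: ennreal
  assumes "q < 1"
  shows "(\<Sum>n. q ^ n) < top"
proof -
  obtain c where c: "0 \<le> c" "q = ennreal c" "c < 1"
    using assms by (cases q) auto
  then show ?thesis
    by (simp add: ennreal_power suminf_ennreal2 summable_geometric)
qed

lemma tendsto_power_ennreal_zero:
  fixes q :: ennreal
  assumes "q < 1"
  shows "(\<lambda>n. q ^ n) \<longlonglongrightarrow> 0"
proof -
  obtain c where c: "0 \<le> c" "q = ennreal c" "c < 1"
    using assms by (cases q) auto
  then have "(\<lambda>n. ennreal (c ^ n)) \<longlonglongrightarrow> ennreal 0"
    by (intro tendsto_ennrealI LIMSEQ_realpow_zero)
  with c show ?thesis
    by (simp add: ennreal_power)
qed

text \<open>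
  Iterating the two inequalities costs a factor \<open>q\<close> in each step, so the defect \<open>u - f\<close>, at most
  \<open>M\<close> at the start, is at most \<open>q ^ n * M\<close> for every \<open>n\<close>.  The source \<open>h\<close> allows potentials of a charge
  to be compared with excessive functions.
\<close>

lemma comparison_principle:
  assumes sub: "substochastic S p" and q: "q < 1" and D: "D \<subseteq> S"
    and u: "\<And>x. x \<in> D \<Longrightarrow> u x \<le> h x + discounted_op q S p u x"
    and f: "\<And>x. x \<in> D \<Longrightarrow> h x + discounted_op q S p f x \<le> f x"
    and bounded: "\<And>x. x \<in> D \<Longrightarrow> u x \<le> M" and M: "M < top"
    and exit: "\<And>x z. x \<in> D \<Longrightarrow> z \<in> S \<Longrightarrow> z \<notin> D \<Longrightarrow> p x z \<noteq> 0 \<Longrightarrow> u z \<le> f z"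
    and "x \<in> D"
  shows "u x \<le> f x"
proof -
  have approx: "\<forall>x\<in>D. u x \<le> f x + q ^ n * M" for n
  proof (induction n)
    case 0
    show ?case using bounded by (auto intro: add_increasing)
  next
    case (Suc n)
    show ?case
    proof
      fix x assume x: "x \<in> D"
      have "u z \<le> f z + q ^ n * M" if "z \<in> S" "p x z \<noteq> 0" for z
        using Suc exit[OF x, of z] that by (cases "z \<in> D") (auto intro: add_increasing2)
      then have "discounted_op q S p u x \<le> discounted_op q S p (\<lambda>z. f z + q ^ n * M) x"
        by (rule discounted_op_mono)
      also have "\<dots> \<le> discounted_op q S p f x + q * (q ^ n * M)"
        unfolding discounted_op_add using D x
        by (intro add_left_mono discounted_op_const_le sub) auto
      finally have "h x + discounted_op q S p u x
          \<le> h x + (discounted_op q S p f x + q * (q ^ n * M))"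
        by (rule add_left_mono)
      then have "u x \<le> h x + discounted_op q S p f x + q * (q ^ n * M)"
        using order_trans[OF u[OF x]] by (simp add: add.assoc)
      also have "\<dots> \<le> f x + q ^ Suc n * M"
        using f[OF x] by (simp add: mult.assoc add_right_mono)
      finally show "u x \<le> f x + q ^ Suc n * M" .
    qed
  qed
  have "(\<lambda>n. M * q ^ n) \<longlonglongrightarrow> M * 0"
    using tendsto_power_ennreal_zero[OF q] M by (intro ennreal_tendsto_cmult)
  then have "(\<lambda>n. f x + q ^ n * M) \<longlonglongrightarrow> f x + 0"
    by (intro tendsto_add tendsto_const) (simp add: mult.commute)
  then show ?thesis
    using approx \<open>x \<in> D\<close> by (intro LIMSEQ_le_const[where X = "\<lambda>n. f x + q ^ n * M"]) auto
qed

section \<open>Potential kernels\<close>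

lemma suminf_split_head_ennreal:
  fixes f :: "nat \<Rightarrow> ennreal"
  shows "suminf f = f 0 + (\<Sum>n. f (Suc n))"
proof -
  have "(\<lambda>n. \<Sum>i<n. f (Suc i)) \<longlonglongrightarrow> (\<Sum>n. f (Suc n))"
    using summable_sums[OF summableI] by (simp add: sums_def)
  then have "(\<lambda>n. f 0 + (\<Sum>i<n. f (Suc i))) \<longlonglongrightarrow> f 0 + (\<Sum>n. f (Suc n))"
    by (intro tendsto_add tendsto_const)
  then have "(\<lambda>n. \<Sum>i<Suc n. f i) \<longlonglongrightarrow> f 0 + (\<Sum>n. f (Suc n))"
    by (subst sum.lessThan_Suc_shift)
  then have "f sums (f 0 + (\<Sum>n. f (Suc n)))"
    unfolding sums_def by (rule LIMSEQ_imp_Suc)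
  then show ?thesis by (rule sums_unique[symmetric])
qed

text \<open>
  The potential kernel for the reference measure that is constantly \<open>1\<close>.  A reference measure
  rescales the columns, so it cancels in Martin kernels.
\<close>

definition green :: "ennreal \<Rightarrow> int set \<Rightarrow> (int \<Rightarrow> int \<Rightarrow> ennreal) \<Rightarrow> int \<Rightarrow> int \<Rightarrow> ennreal" where
  "green q S p x y = (\<Sum>n. q ^ n * transition_power S p n x y)"

lemma potential_kernel_eq_green: "potential_kernel S p \<pi> q x y = green q S p x y / \<pi> y"
  by (simp add: potential_kernel_def green_def ennreal_times_divide)

text \<open>
  The series is split after its first term: the chain either is at \<open>y\<close> now or is followed from its
  next state on.
\<close>

lemma green_resolvent:
  "green q S p x y = (if x = y then 1 else 0) + discounted_op q S p (\<lambda>z. green q S p z y) x"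
proof -
  let ?a = "\<lambda>n. q ^ n * transition_power S p n x y"
  have "green q S p x y = ?a 0 + (\<Sum>n. ?a (Suc n))"
    unfolding green_def by (rule suminf_split_head_ennreal)
  also have "(\<Sum>n. ?a (Suc n))
      = (\<Sum>n. \<integral>\<^sup>+ z. q * (p x z * (q ^ n * transition_power S p n z y)) \<partial>count_space S)"
    by (intro suminf_cong) (simp add: nn_integral_cmult ac_simps flip: nn_integral_cmult)
  also have "\<dots> = (\<integral>\<^sup>+ z. (\<Sum>n. q * (p x z * (q ^ n * transition_power S p n z y))) \<partial>count_space S)"
    by (rule nn_integral_suminf[symmetric]) simp
  also have "\<dots> = discounted_op q S p (\<lambda>z. green q S p z y) x"
    by (simp add: discounted_op_def green_def nn_integral_cmult)
  finally show ?thesis by simp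
qed

lemma transition_power_le_one:
  assumes "substochastic S p" "x \<in> S"
  shows "transition_power S p n x y \<le> 1"
  using assms(2)
proof (induction n arbitrary: x)
  case (Suc n)
  then show ?case
    using discounted_op_le_bound[OF assms(1) Suc.prems, of "\<lambda>z. transition_power S p n z y" 1 1]
    by (simp add: discounted_op_def)
qed simp

lemma green_le_geometric:
  assumes "substochastic S p" "x \<in> S"
  shows "green q S p x y \<le> (\<Sum>n. q ^ n)"
  unfolding green_def
proof (intro suminf_le summableI)
  fix n show "q ^ n * transition_power S p n x y \<le> q ^ n"
    using mult_left_mono[OF transition_power_le_one[OF assms], of "q ^ n" n y] by simp
qed

section \<open>First passage upwards and the increasing harmonic function\<close>

text \<open>
  By the strong Markov property at the first hitting time \<open>T\<close> of \<open>y\<close>, this quotient is the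
  expectation of \<open>q ^ T\<close> for the chain started at \<open>x\<close>.  Analytically it is the bounded function of
  \<open>x\<close> that is harmonic off \<open>y\<close> and has the value \<open>1\<close> at \<open>y\<close>.
\<close>

definition hitting :: "ennreal \<Rightarrow> int set \<Rightarrow> (int \<Rightarrow> int \<Rightarrow> ennreal) \<Rightarrow> int \<Rightarrow> int \<Rightarrow> ennreal" where
  "hitting q S p x y = green q S p x y / green q S p y y"

text \<open>
  The function \<open>H\<close>, without a limit: at or above \<open>max x ref\<close> the quotient no longer depends on the
  target of the passage (\<open>extremal_eq\<close>).
\<close>

definition extremal :: "ennreal \<Rightarrow> int set \<Rightarrow> (int \<Rightarrow> int \<Rightarrow> ennreal) \<Rightarrow> int \<Rightarrow> int \<Rightarrow> ennreal" where
  "extremal q S p ref x = hitting q S p x (max x ref) / hitting q S p ref (max x ref)"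

lemma minimal_q_excessiveD:
  assumes "f \<in> minimal_q_excessive q E S p" "f1 \<in> q_excessive q E S p" "f2 \<in> q_excessive q E S p"
    and "\<And>x. x \<in> S \<Longrightarrow> f x = f1 x + f2 x"
  shows "\<exists>d<top. \<forall>x\<in>S. f1 x = d * f x"
  using assms unfolding minimal_q_excessive_def by blast

text \<open>
  These conditions pass to the restriction to \<open>{x. y < x}\<close> and hold for the reflected dual chain, so
  one development serves the chain, the killed chains and the dual.
\<close>

locale skip_free_kernel =
  fixes S :: "int set" and p :: "int \<Rightarrow> int \<Rightarrow> ennreal" and q :: ennreal
  assumes interval: "x \<in> S \<Longrightarrow> y \<in> S \<Longrightarrow> x \<le> z \<Longrightarrow> z \<le> y \<Longrightarrow> z \<in> S"
    and substoch: "substochastic S p"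
    and up_pos: "x \<in> S \<Longrightarrow> x + 1 \<in> S \<Longrightarrow> 0 < p x (x + 1)"
    and skip_free: "x \<in> S \<Longrightarrow> y \<in> S \<Longrightarrow> x + 1 < y \<Longrightarrow> p x y = 0"
    and q_pos: "0 < q" and q_less_one: "q < 1"
begin

abbreviation "A \<equiv> discounted_op q S p"
abbreviation "g \<equiv> green q S p"
abbreviation "\<phi> \<equiv> hitting q S p"

lemma green_finite: "x \<in> S \<Longrightarrow> g x y < top"
  using green_le_geometric[OF substoch] suminf_power_ennreal_less_top[OF q_less_one]
  by (meson order.strict_trans1)

lemma green_diag_ge_one: "1 \<le> g y y"
  by (subst green_resolvent) simp

text \<open>
  Off \<open>y\<close> the column \<open>g \<cdot> y\<close> is harmonic and bounded, and constants are superharmonic; hence its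
  maximum is at \<open>y\<close>.
\<close>

lemma green_le_diag:
  assumes "x \<in> S" "y \<in> S"
  shows "g x y \<le> g y y"
proof (cases "x = y")
  case False
  show ?thesis
  proof (rule comparison_principle[OF substoch q_less_one, where D = "S - {y}" and h = "\<lambda>_. 0"
        and u = "\<lambda>x. g x y" and f = "\<lambda>_. g y y"])
    show "g x y \<le> 0 + A (\<lambda>x. g x y) x" if "x \<in> S - {y}" for x
      using that green_resolvent[of q S p x y] by simp
    show "0 + A (\<lambda>_. g y y) x \<le> g y y" if "x \<in> S - {y}" for x
    proof -
      have "A (\<lambda>_. g y y) x \<le> q * g y y"
        using that by (intro discounted_op_const_le[OF substoch]) auto
      also have "\<dots> \<le> 1 * g y y"
        by (intro mult_right_mono) (use q_less_one in auto)
      finally show ?thesis by simp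
    qed
    show "g x y \<le> (\<Sum>n. q ^ n)" if "x \<in> S - {y}" for x
      using that green_le_geometric[OF substoch] by auto
    show "(\<Sum>n. q ^ n) < top"
      by (rule suminf_power_ennreal_less_top[OF q_less_one])
  qed (use assms False in auto)
qed simp

lemma green_diag_neq: "y \<in> S \<Longrightarrow> g y y \<noteq> 0" "y \<in> S \<Longrightarrow> g y y \<noteq> top"
  using green_diag_ge_one[of y] green_finite[of y y] by auto

lemma green_diag_divide_self: "y \<in> S \<Longrightarrow> g y y / g y y = 1"
  using green_diag_neq[of y] green_finite[of y y] by simp

lemma hitting_self: "y \<in> S \<Longrightarrow> \<phi> y y = 1"
  by (simp add: hitting_def green_diag_divide_self)

lemma green_eq_hitting: "y \<in> S \<Longrightarrow> g x y = \<phi> x y * g y y"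
  by (simp add: hitting_def ennreal_divide_times green_diag_divide_self)

lemma hitting_le_one: "x \<in> S \<Longrightarrow> y \<in> S \<Longrightarrow> \<phi> x y \<le> 1"
  using divide_right_mono_ennreal[OF green_le_diag[of x y], of "g y y"]
  by (simp add: hitting_def green_diag_divide_self)

lemma hitting_finite: "x \<in> S \<Longrightarrow> y \<in> S \<Longrightarrow> \<phi> x y < top"
  using hitting_le_one[of x y] by (rule order.strict_trans1) auto

lemma hitting_harmonic: "x \<noteq> y \<Longrightarrow> A (\<lambda>z. \<phi> z y) x = \<phi> x y"
  using green_resolvent[of q S p x y] by (simp add: hitting_def discounted_op_divide)

lemma hitting_excessive: "A (\<lambda>z. \<phi> z y) x \<le> \<phi> x y"
  unfolding hitting_def discounted_op_divide
  by (subst (2) green_resolvent) (auto intro: divide_right_mono_ennreal)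

text \<open>
  Downward induction from \<open>y\<close>: a single step up has positive probability.
\<close>

lemma hitting_pos:
  assumes "x \<in> S" "y \<in> S" "x \<le> y"
  shows "0 < \<phi> x y"
  using assms(3,1)
proof (induction x rule: int_le_induct)
  case base
  then show ?case by (simp add: hitting_self)
next
  case (step i)
  then have i: "i \<in> S" using interval[of "i - 1" y i] assms(2) by simp
  have "0 < q * (p (i - 1) i * \<phi> i y)"
    using step i up_pos[of "i - 1"] q_pos by (simp add: ennreal_zero_less_mult_iff)
  also have "\<dots> \<le> A (\<lambda>z. \<phi> z y) (i - 1)"
    by (rule discounted_op_ge_summand[OF i])
  also have "\<dots> \<le> \<phi> (i - 1) y" by (rule hitting_excessive)
  finally show ?case .
qed

lemma hitting_neq:
  assumes "x \<in> S" "y \<in> S" "x \<le> y"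
  shows "\<phi> x y \<noteq> 0" "\<phi> x y \<noteq> top"
  using hitting_pos[OF assms] hitting_finite[OF assms(1,2)] by auto

lemma exit_upwards:
  assumes "x \<in> S" "x < y" "z \<in> S" "\<not> z < y" "p x z \<noteq> 0"
  shows "z = y"
  using skip_free[of x z] assms by force

text \<open>
  Together with the next lemma this identifies the bounded functions that are harmonic below \<open>y\<close>:
  the only exit from \<open>{x. x < y}\<close> is \<open>y\<close>, where \<open>\<phi> \<cdot> y\<close> is \<open>1\<close>.
\<close>

lemma subharmonic_le_hitting:
  assumes "\<And>x. x \<in> S \<Longrightarrow> x < y \<Longrightarrow> u x \<le> A u x"
    and "\<And>x. x \<in> S \<Longrightarrow> x < y \<Longrightarrow> u x \<le> M" "M < top"
    and "x \<in> S" "y \<in> S" "x \<le> y"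
  shows "u x \<le> \<phi> x y * u y"
proof (cases "x = y")
  case False
  show ?thesis
  proof (rule comparison_principle[OF substoch q_less_one, where D = "{x \<in> S. x < y}"
        and h = "\<lambda>_. 0" and u = u and f = "\<lambda>x. \<phi> x y * u y" and M = M])
    show "0 + A (\<lambda>x. \<phi> x y * u y) x \<le> \<phi> x y * u y" for x
      using discounted_op_cmult[of q S p "u y" "\<lambda>x. \<phi> x y" x] hitting_excessive[of y x]
      by (simp add: mult.commute mult_left_mono)
    show "u z \<le> \<phi> z y * u y"
      if "x \<in> {x \<in> S. x < y}" "z \<in> S" "z \<notin> {x \<in> S. x < y}" "p x z \<noteq> 0" for x z
      using exit_upwards[of x y z] that by (simp add: hitting_self)
  qed (use assms False in auto)
qed (use assms in \<open>simp add: hitting_self\<close>)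

lemma hitting_le_superharmonic:
  assumes "\<And>x. x \<in> S \<Longrightarrow> x < y \<Longrightarrow> A f x \<le> f x"
    and "f y < top" and "x \<in> S" "y \<in> S" "x \<le> y"
  shows "\<phi> x y * f y \<le> f x"
proof (cases "x = y")
  case False
  show ?thesis
  proof (rule comparison_principle[OF substoch q_less_one, where D = "{x \<in> S. x < y}"
        and h = "\<lambda>_. 0" and f = f and u = "\<lambda>x. \<phi> x y * f y" and M = "f y"])
    show "\<phi> x y * f y \<le> 0 + A (\<lambda>x. \<phi> x y * f y) x" if "x \<in> {x \<in> S. x < y}" for x
      using discounted_op_cmult[of q S p "f y" "\<lambda>x. \<phi> x y" x] hitting_harmonic[of x y] that
      by (simp add: mult.commute)
    show "\<phi> x y * f y \<le> f y" if "x \<in> {x \<in> S. x < y}" for x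
      using mult_right_mono[OF hitting_le_one[of x y], of "f y"] that assms by simp
    show "\<phi> z y * f y \<le> f z"
      if "x \<in> {x \<in> S. x < y}" "z \<in> S" "z \<notin> {x \<in> S. x < y}" "p x z \<noteq> 0" for x z
      using exit_upwards[of x y z] that by (simp add: hitting_self)
  qed (use assms False in auto)
qed (use assms in \<open>simp add: hitting_self\<close>)

text \<open>
  As a function of \<open>x\<close>, \<open>\<phi> x z\<close> is bounded and harmonic below \<open>y\<close>, because \<open>y \<le> z\<close>.
\<close>

lemma hitting_mult:
  assumes "x \<in> S" "y \<in> S" "z \<in> S" "x \<le> y" "y \<le> z"
  shows "\<phi> x z = \<phi> x y * \<phi> y z"
proof (rule antisym)
  show "\<phi> x z \<le> \<phi> x y * \<phi> y z"
    by (rule subharmonic_le_hitting[where M = 1])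
      (use assms hitting_le_one in \<open>auto simp: hitting_harmonic\<close>)
  show "\<phi> x y * \<phi> y z \<le> \<phi> x z"
    by (rule hitting_le_superharmonic) (use assms hitting_excessive hitting_finite in auto)
qed

lemma extremal_eq:
  assumes "x \<in> S" "ref \<in> S" "m \<in> S" "x \<le> m" "ref \<le> m"
  shows "extremal q S p ref x = \<phi> x m / \<phi> ref m"
proof -
  define n where "n = max x ref"
  have n: "n \<in> S" "x \<le> n" "ref \<le> n" "n \<le> m"
    using assms by (auto simp: n_def max_def)
  then have "\<phi> x m / \<phi> ref m = (\<phi> x n * \<phi> n m) / (\<phi> ref n * \<phi> n m)"
    using assms hitting_mult[of x n m] hitting_mult[of ref n m] by simp
  also have "\<dots> = \<phi> x n / \<phi> ref n"
    using hitting_neq[of n m] n assms by (intro divide_mult_eq) auto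
  finally show ?thesis by (simp add: extremal_def n_def)
qed

lemma max_in: "x \<in> S \<Longrightarrow> y \<in> S \<Longrightarrow> max x y \<in> S"
  by (simp add: max_def)

lemma extremal_neq:
  assumes "x \<in> S" "ref \<in> S"
  shows "extremal q S p ref x \<noteq> 0" "extremal q S p ref x \<noteq> top"
  using hitting_neq[of x "max x ref"] hitting_neq[of ref "max x ref"] assms max_in[OF assms]
  by (auto simp: extremal_def ennreal_divide_eq_top_iff)

lemma extremal_ref: "ref \<in> S \<Longrightarrow> extremal q S p ref ref = 1"
  by (simp add: extremal_def hitting_self)

lemma extremal_hitting:
  assumes "x \<in> S" "ref \<in> S" "y \<in> S" "x \<le> y"
  shows "extremal q S p ref x = \<phi> x y * extremal q S p ref y"
proof -
  let ?m = "max y ref"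
  have "?m \<in> S" using assms max_in by simp
  then show ?thesis
    using extremal_eq[of x ref ?m] extremal_eq[of y ref ?m] hitting_mult[of x y ?m] assms
    by (simp add: ennreal_times_divide)
qed

lemma extremal_mono:
  assumes "x \<in> S" "ref \<in> S" "y \<in> S" "x \<le> y"
  shows "extremal q S p ref x \<le> extremal q S p ref y"
  using mult_right_mono[OF hitting_le_one[of x y], of "extremal q S p ref y"]
    extremal_hitting[of x ref y] assms by simp

lemma discounted_extremal_eq:
  assumes "x \<in> S" "ref \<in> S" "m \<in> S" "ref \<le> m" "\<And>z. z \<in> S \<Longrightarrow> p x z \<noteq> 0 \<Longrightarrow> z \<le> m"
  shows "A (extremal q S p ref) x = A (\<lambda>z. \<phi> z m) x / \<phi> ref m"
  unfolding discounted_op_divide[symmetric]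
  using assms by (intro discounted_op_cong extremal_eq) auto

text \<open>
  Near \<open>x\<close> the function is a multiple of \<open>\<phi> \<cdot> m\<close> with \<open>m > x\<close>, which is harmonic at \<open>x\<close>.  A target
  above \<open>x\<close> exists because \<open>x\<close> is not the greatest state.
\<close>

lemma extremal_harmonic:
  assumes "x \<in> S" "ref \<in> S" "x + 1 \<in> S"
  shows "A (extremal q S p ref) x = extremal q S p ref x"
proof -
  let ?m = "max (x + 1) ref"
  have m: "?m \<in> S" using assms max_in by simp
  have "A (extremal q S p ref) x = A (\<lambda>z. \<phi> z ?m) x / \<phi> ref ?m"
    using assms m skip_free[of x] by (intro discounted_extremal_eq) force+
  also have "\<dots> = extremal q S p ref x"
    using assms m by (subst hitting_harmonic) (auto simp: extremal_eq[of x ref ?m])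
  finally show ?thesis .
qed

lemma le_top_state:
  assumes "x \<in> S" "x + 1 \<notin> S" "z \<in> S"
  shows "z \<le> x"
  using interval[of x z "x + 1"] assms by force

lemma extremal_excessive:
  assumes "x \<in> S" "ref \<in> S"
  shows "A (extremal q S p ref) x \<le> extremal q S p ref x"
proof (cases "x + 1 \<in> S")
  case False
  then have "A (extremal q S p ref) x = A (\<lambda>z. \<phi> z x) x / \<phi> ref x"
    using assms le_top_state by (intro discounted_extremal_eq) auto
  also have "\<dots> \<le> \<phi> x x / \<phi> ref x"
    by (intro divide_right_mono_ennreal hitting_excessive)
  also have "\<dots> = extremal q S p ref x"
    using False assms le_top_state by (intro extremal_eq[symmetric]) auto
  finally show ?thesis .
qed (use extremal_harmonic assms in auto)

lemma martin_kernel_eq_extremal: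
  assumes "x \<in> S" "ref \<in> S" "y \<in> S" "x \<le> y" "ref \<le> y" "0 < \<pi> y" "\<pi> y < top"
  shows "martin_kernel S p \<pi> q ref x y = extremal q S p ref x"
proof -
  have *: "a / c / (b / c) = a / b" if "c \<noteq> 0" "c \<noteq> top" for a b c :: ennreal
    using that divide_mult_eq[of "inverse c" a b] by (simp add: divide_ennreal_def)
  have "martin_kernel S p \<pi> q ref x y = g x y / g ref y"
    using assms by (simp add: martin_kernel_def potential_kernel_eq_green *)
  also have "\<dots> = \<phi> x y / \<phi> ref y"
    using assms green_diag_neq[of y] by (simp add: hitting_def *)
  finally show ?thesis using assms by (simp add: extremal_eq[of x ref y])
qed

text \<open>
  Both \<open>f x\<close> and \<open>f ref\<close> are read off from the value of \<open>f\<close> at a common higher state.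
\<close>

lemma multiple_of_extremal:
  assumes "ref \<in> S" "x \<in> S" "\<And>x y. x \<in> S \<Longrightarrow> y \<in> S \<Longrightarrow> x \<le> y \<Longrightarrow> f x = \<phi> x y * f y"
  shows "f x = f ref * extremal q S p ref x"
proof -
  define m where "m = max x ref"
  have m: "m \<in> S" "x \<le> m" "ref \<le> m" using assms by (auto simp: m_def max_def)
  have "f ref * (\<phi> x m / \<phi> ref m) = \<phi> x m * f m * \<phi> ref m / \<phi> ref m"
    using assms(3)[of ref m] m assms(1) by (simp add: ennreal_times_divide mult_ac)
  also have "\<dots> = \<phi> x m * f m"
    using hitting_neq[of ref m] m assms(1) by (simp add: ennreal_mult_divide_eq)
  finally show ?thesis
    using assms(3)[of x m] m assms(1,2) by (simp add: extremal_eq[of x ref m])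
qed

text \<open>
  Monotonicity supplies the bound on \<open>{x. x < y}\<close> that makes comparison applicable from above.
\<close>

lemma increasing_harmonic_below_top:
  assumes "mono_on S f" "\<And>x. x \<in> S \<Longrightarrow> f x < top"
    and "\<And>x. x \<in> S \<Longrightarrow> x + 1 \<in> S \<Longrightarrow> A f x = f x"
    and "ref \<in> S" "x \<in> S"
  shows "f x = f ref * extremal q S p ref x"
proof (rule multiple_of_extremal)
  fix x y assume xy: "x \<in> S" "y \<in> S" "x \<le> y"
  have A: "A f z = f z" if "z \<in> S" "z < y" for z
    using assms(3) that interval[of z y "z + 1"] xy by auto
  show "f x = \<phi> x y * f y"
  proof (rule antisym)
    show "f x \<le> \<phi> x y * f y"
      by (rule subharmonic_le_hitting[where M = "f y"])
        (use A xy assms in \<open>auto intro: mono_onD\<close>)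
    show "\<phi> x y * f y \<le> f x"
      by (rule hitting_le_superharmonic) (use A xy assms in auto)
  qed
qed fact+

text \<open>
  The atom at \<open>y\<close> of the Riesz decomposition of \<open>f\<close>: \<open>c\<close> is the charge \<open>f - q P f\<close> at \<open>y\<close>, its
  potential is the column \<open>c * g \<cdot> y\<close>, and removing this potential leaves an excessive function.
\<close>

lemma excessive_minus_charge:
  assumes f: "f \<in> q_excessive q S S p" and y: "y \<in> S"
  defines "c \<equiv> f y - A f y"
  shows "\<And>x. x \<in> S \<Longrightarrow> c * g x y \<le> f x"
    and "(\<lambda>x. f x - c * g x y) \<in> q_excessive q S S p"
    and "(\<lambda>x. c * g x y) \<in> q_excessive q S S p"
proof -
  have fin: "f x < top" and exc: "A f x \<le> f x" if "x \<in> S" for x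
    using f that by (auto simp: q_excessive_def)
  have c: "c < top" using fin[OF y] by (auto simp: c_def diff_less_top_ennreal)
  define h where "h = (\<lambda>x. if x = y then c else 0)"
  have pot: "c * g x y = h x + A (\<lambda>x. c * g x y) x" for x
    by (subst green_resolvent) (auto simp: discounted_op_cmult distrib_left h_def)
  \<comment> \<open>At \<open>y\<close> the source \<open>h\<close> fills the gap between \<open>A f y\<close> and \<open>f y\<close> exactly.\<close>
  have f_ge: "h x + A f x \<le> f x" if "x \<in> S" for x
    using exc[OF that] by (auto simp: h_def c_def diff_add_cancel_ennreal)
  show le: "c * g x y \<le> f x" if "x \<in> S" for x
  proof (rule comparison_principle[OF substoch q_less_one, where D = S and h = h
        and u = "\<lambda>x. c * g x y" and f = f])
    show "c * g x y \<le> c * g y y" if "x \<in> S" for x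
      using that y by (intro mult_left_mono green_le_diag) auto
    show "c * g y y < top"
      using c green_finite[OF y] by (simp add: ennreal_mult_less_top)
    show "c * g x y \<le> h x + A (\<lambda>x. c * g x y) x" for x
      by (rule eq_refl[OF pot])
  qed (use f_ge that in auto)
  show "(\<lambda>x. c * g x y) \<in> q_excessive q S S p"
    unfolding q_excessive_def
  proof safe
    fix x assume "x \<in> S"
    then show "c * g x y < top" using c green_finite by (simp add: ennreal_mult_less_top)
    show "A (\<lambda>x. c * g x y) x \<le> c * g x y"
      unfolding pot[of x] by simp
  qed
  show "(\<lambda>x. f x - c * g x y) \<in> q_excessive q S S p"
    unfolding q_excessive_def
  proof safe
    fix x assume x: "x \<in> S"
    let ?f2 = "\<lambda>x. f x - c * g x y"
    show "?f2 x < top" using fin[OF x] by (simp add: diff_less_top_ennreal)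
    have "A f x = A (\<lambda>z. ?f2 z + c * g z y) x"
      by (rule discounted_op_cong) (simp add: le diff_add_cancel_ennreal)
    then have "c * g x y + A ?f2 x = h x + A f x"
      unfolding pot[of x] by (simp add: discounted_op_add add_ac)
    also have "\<dots> \<le> c * g x y + ?f2 x"
      using f_ge[OF x] le[OF x] by (simp add: add_diff_inverse_ennreal)
    finally show "A ?f2 x \<le> ?f2 x"
      using le[OF x] fin[OF x] by (auto simp: ennreal_add_left_cancel_le)
  qed
qed

text \<open>
  From \<open>y + 1\<close> the chain needs at least one step to reach \<open>y\<close>, at the price of a factor \<open>q\<close>.
\<close>

lemma green_step_up_less:
  assumes "y \<in> S" "y + 1 \<in> S"
  shows "g (y + 1) y < g y y"
proof -
  have "g (y + 1) y = A (\<lambda>z. g z y) (y + 1)"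
    by (subst green_resolvent) simp
  also have "\<dots> \<le> q * g y y"
    using assms by (intro discounted_op_le_bound[OF substoch] green_le_diag)
  also have "\<dots> < 1 * g y y"
    using green_diag_neq[of y] assms q_less_one
    by (intro ennreal_mult_strict_right_mono) (auto simp: less_top zero_less_iff_neq_zero)
  finally show ?thesis by simp
qed

text \<open>
  A charge at \<open>y\<close> would make the minimal function \<open>f\<close> a multiple of \<open>g \<cdot> y\<close>, which is smaller at
  \<open>y + 1\<close> than at \<open>y\<close>.
\<close>

lemma increasing_minimal_harmonic:
  assumes "f \<in> minimal_q_excessive q S S p" "mono_on S f" "y \<in> S" "y + 1 \<in> S"
  shows "A f y = f y"
proof (rule ccontr)
  assume neq: "A f y \<noteq> f y"
  have f: "f \<in> q_excessive q S S p"
    using assms by (simp add: minimal_q_excessive_def)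
  define c where "c = f y - A f y"
  note part = excessive_minus_charge[OF f assms(3), folded c_def]
  have fy: "A f y \<le> f y" "f y < top" using f assms by (auto simp: q_excessive_def)
  then have c0: "c \<noteq> 0" using neq by (auto simp: c_def diff_eq_0_iff_ennreal)
  have "\<exists>d<top. \<forall>x\<in>S. c * g x y = d * f x"
    by (rule minimal_q_excessiveD[OF assms(1) part(3,2)])
      (simp add: part(1) add_diff_inverse_ennreal)
  then obtain d where d: "d < top" "\<And>x. x \<in> S \<Longrightarrow> c * g x y = d * f x" by auto
  have "c * g y y \<le> c * g (y + 1) y"
    using d assms mono_onD[OF assms(2), of y "y + 1"] by (auto intro: mult_left_mono)
  moreover have "c < top" using fy by (simp add: c_def diff_less_top_ennreal)
  then have "c * g (y + 1) y < c * g y y"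
    using green_step_up_less[OF assms(3,4)] c0
    by (intro ennreal_mult_strict_left_mono) (auto simp: zero_less_iff_neq_zero)
  ultimately show False by simp
qed

lemma multiple_of_extremal_increasing:
  assumes "ref \<in> S" "\<And>x. x \<in> S \<Longrightarrow> h x = c * extremal q S p ref x"
  shows "mono_on S h"
  using assms extremal_mono by (auto intro!: mono_onI mult_left_mono)

lemma multiple_of_extremal_op:
  assumes "\<And>x. x \<in> S \<Longrightarrow> h x = c * extremal q S p ref x"
  shows "A h x = c * A (extremal q S p ref) x"
  unfolding discounted_op_cmult[symmetric] using assms by (intro discounted_op_cong)

text \<open>
  Excessive functions satisfy \<open>f x \<ge> \<phi> x y * f y\<close> for \<open>x \<le> y\<close>, and a multiple of \<open>extremal\<close> attains
  equality.  If it is a sum of two excessive functions, both must therefore attain equality, which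
  makes them multiples of \<open>extremal\<close> as well.
\<close>

lemma multiple_of_extremal_minimal:
  assumes ref: "ref \<in> S" and c: "0 < c" "c < top"
    and h: "\<And>x. x \<in> S \<Longrightarrow> h x = c * extremal q S p ref x"
  shows "h \<in> minimal_q_excessive q S S p"
proof -
  have fin: "h x < top" if "x \<in> S" for x
    using h[OF that] extremal_neq[OF that ref] c by (simp add: ennreal_mult_less_top less_top)
  have "A h x = c * A (extremal q S p ref) x" for x
    by (rule multiple_of_extremal_op) (rule h)
  then have "h \<in> q_excessive q S S p"
    using fin extremal_excessive ref by (auto simp: q_excessive_def h intro: mult_left_mono)
  moreover have "\<exists>x\<in>S. h x \<noteq> 0"
    using ref c by (intro bexI[of _ ref]) (auto simp: h extremal_ref)
  moreover have "(\<exists>d<top. \<forall>x\<in>S. f1 x = d * h x) \<and> (\<exists>d<top. \<forall>x\<in>S. f2 x = d * h x)"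
    if f: "f1 \<in> q_excessive q S S p" "f2 \<in> q_excessive q S S p"
      and sum: "\<forall>x\<in>S. h x = f1 x + f2 x" for f1 f2
  proof -
    have ge: "\<phi> x y * f y \<le> f x"
      if "f \<in> q_excessive q S S p" "x \<in> S" "y \<in> S" "x \<le> y" for f x y
      using that by (intro hitting_le_superharmonic) (auto simp: q_excessive_def)
    \<comment> \<open>Two inequalities whose sums agree are equalities.\<close>
    have add: "a = a'" if "a \<le> a'" "b \<le> b'" "a + b = a' + b'" "a' + b' < top"
      for a b a' b' :: ennreal
    proof -
      have "b' + a' \<le> b' + a" using that by (metis add.commute add_left_mono)
      then show ?thesis using that by (auto simp: ennreal_add_left_cancel_le)
    qed
    have scale: "f1 x = \<phi> x y * f1 y" "f2 x = \<phi> x y * f2 y" if xy: "x \<in> S" "y \<in> S" "x \<le> y" for x y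
    proof -
      have "h x = \<phi> x y * h y"
        using extremal_hitting[of x ref y] xy ref by (simp add: h mult.left_commute)
      then have eq: "\<phi> x y * f1 y + \<phi> x y * f2 y = f1 x + f2 x"
        using sum xy by (simp add: distrib_left)
      have lt: "f1 x + f2 x < top" using fin[of x] sum xy by simp
      show "f1 x = \<phi> x y * f1 y"
        by (rule add[OF ge[OF f(1) xy] ge[OF f(2) xy] eq lt, symmetric])
      show "f2 x = \<phi> x y * f2 y"
        using eq lt by (intro add[OF ge[OF f(2) xy] ge[OF f(1) xy], symmetric])
          (simp_all add: add.commute)
    qed
    have "\<exists>d<top. \<forall>x\<in>S. f x = d * h x"
      if "f \<in> q_excessive q S S p" "\<And>x y. x \<in> S \<Longrightarrow> y \<in> S \<Longrightarrow> x \<le> y \<Longrightarrow> f x = \<phi> x y * f y" for f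
    proof (intro exI conjI ballI)
      have "f ref < top" using that(1) ref by (auto simp: q_excessive_def)
      then show "f ref / c < top"
        using c by (auto simp: less_top[symmetric] ennreal_divide_eq_top_iff)
      fix x assume x: "x \<in> S"
      have "f ref / c * h x = f ref * (extremal q S p ref x * c / c)"
        using x by (simp add: h ennreal_divide_times ennreal_times_divide mult.commute)
      also have "\<dots> = f ref * extremal q S p ref x"
        using c by (subst ennreal_mult_divide_eq) auto
      also have "\<dots> = f x"
        using multiple_of_extremal[OF ref x that(2)] by simp
      finally show "f x = f ref / c * h x" by simp
    qed
    then show ?thesis using f scale by blast
  qed
  ultimately show ?thesis
    unfolding minimal_q_excessive_def by blast
qed

theorem minimal_increasing_iff:
  assumes ref: "ref \<in> S"
  shows "f \<in> minimal_q_excessive q S S p \<and> mono_on S f \<longleftrightarrow>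
    (\<exists>c. 0 < c \<and> c < top \<and> (\<forall>x\<in>S. f x = c * extremal q S p ref x))"
proof
  assume f: "f \<in> minimal_q_excessive q S S p \<and> mono_on S f"
  then have fin: "f x < top" if "x \<in> S" for x
    using that by (auto simp: minimal_q_excessive_def q_excessive_def)
  have eq: "f x = f ref * extremal q S p ref x" if "x \<in> S" for x
    using f fin increasing_minimal_harmonic ref that by (intro increasing_harmonic_below_top) auto
  obtain x where "x \<in> S" "f x \<noteq> 0"
    using f by (auto simp: minimal_q_excessive_def)
  with eq[of x] have "0 < f ref" by (auto simp: zero_less_iff_neq_zero)
  with eq fin[OF ref] show "\<exists>c. 0 < c \<and> c < top \<and> (\<forall>x\<in>S. f x = c * extremal q S p ref x)"
    by blast
next
  assume "\<exists>c. 0 < c \<and> c < top \<and> (\<forall>x\<in>S. f x = c * extremal q S p ref x)"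
  then show "f \<in> minimal_q_excessive q S S p \<and> mono_on S f"
    using multiple_of_extremal_minimal[OF ref] multiple_of_extremal_increasing[OF ref] by blast
qed

theorem increasing_harmonic_iff:
  assumes ref: "ref \<in> S" and E: "E = {x \<in> S. x + 1 \<in> S}"
  shows "f \<in> q_harmonic q E S p \<and> mono_on S f \<longleftrightarrow>
    (\<exists>c<top. \<forall>x\<in>S. f x = c * extremal q S p ref x)"
proof
  assume f: "f \<in> q_harmonic q E S p \<and> mono_on S f"
  have "f x = f ref * extremal q S p ref x" if "x \<in> S" for x
    using f ref that by (intro increasing_harmonic_below_top) (auto simp: q_harmonic_def E)
  moreover have "f ref < top" using f ref by (auto simp: q_harmonic_def)
  ultimately show "\<exists>c<top. \<forall>x\<in>S. f x = c * extremal q S p ref x" by blast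
next
  assume "\<exists>c<top. \<forall>x\<in>S. f x = c * extremal q S p ref x"
  then obtain c where c: "c < top" and f: "\<And>x. x \<in> S \<Longrightarrow> f x = c * extremal q S p ref x" by blast
  have "f x < top" if "x \<in> S" for x
    using f[OF that] extremal_neq[OF that ref] c by (simp add: ennreal_mult_less_top less_top)
  moreover have "A f x = c * A (extremal q S p ref) x" for x
    by (rule multiple_of_extremal_op) (rule f)
  ultimately have "f \<in> q_harmonic q E S p"
    using extremal_harmonic ref by (auto simp: q_harmonic_def f E)
  then show "f \<in> q_harmonic q E S p \<and> mono_on S f"
    using multiple_of_extremal_increasing[OF ref f] by simp
qed

text \<open>
  \<open>(q P)\<^sup>n f \<le> q\<^sup>n M\<close>.  With a non-absorbing right end the increasing function \<open>H\<close> is bounded by its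
  value there, and this makes it a potential.
\<close>

lemma bounded_excessive_is_potential:
  assumes "f \<in> q_excessive q S S p" "\<And>x. x \<in> S \<Longrightarrow> f x \<le> M" "M < top"
  shows "f \<in> q_potential q S S p"
proof -
  have "\<forall>x\<in>S. (A ^^ n) f x \<le> q ^ n * M" for n
  proof (induction n)
    case (Suc n)
    then have "A ((A ^^ n) f) x \<le> q * (q ^ n * M)" if "x \<in> S" for x
      using that by (intro discounted_op_le_bound[OF substoch]) auto
    then show ?case by (simp add: mult.assoc)
  qed (use assms(2) in simp)
  moreover have "(\<lambda>n. M * q ^ n) \<longlonglongrightarrow> M * 0"
    by (intro ennreal_tendsto_cmult tendsto_power_ennreal_zero assms q_less_one)
  ultimately have "(\<lambda>n. (A ^^ n) f x) \<longlonglongrightarrow> 0" if "x \<in> S" for x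
    using that
    by (intro tendsto_sandwich[of "\<lambda>_. 0" "\<lambda>n. (A ^^ n) f x" sequentially "\<lambda>n. M * q ^ n"])
      (auto simp: mult.commute[of M])
  then show ?thesis using assms(1) by (simp add: q_potential_def)
qed

text \<open>
  The row of \<open>x\<close> has total mass at most \<open>1\<close>, all of it on the diagonal.
\<close>

lemma absorbing_row:
  assumes "x \<in> S" "p x x = 1" "z \<in> S" "z \<noteq> x"
  shows "p x z = 0"
proof -
  have "p x x + p x z = discounted_op 1 {x, z} p (\<lambda>_. 1) x"
    using assms by (simp add: discounted_op_def nn_integral_count_space_finite)
  also have "\<dots> \<le> discounted_op 1 S p (\<lambda>_. 1) x"
    using assms by (intro discounted_op_subset_le) auto
  also have "\<dots> \<le> 1 * 1"
    by (rule discounted_op_const_le[OF substoch assms(1)])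
  finally have "1 + p x z \<le> 1 + 0" using assms by simp
  then show ?thesis by (subst (asm) ennreal_add_left_cancel_le) auto
qed

lemma absorbing_op:
  assumes "x \<in> S" "p x x = 1"
  shows "A f x = q * f x"
proof -
  have "A f x = A (\<lambda>z. if z = x then f z else 0) x"
    using absorbing_row[OF assms] by (intro discounted_op_cong) auto
  also have "\<dots> = discounted_op q {x} p (\<lambda>z. if z = x then f z else 0) x"
    using assms by (intro discounted_op_subset) auto
  also have "\<dots> = q * f x"
    using assms by (simp add: discounted_op_def nn_integral_count_space_finite)
  finally show ?thesis .
qed

text \<open>
  At an absorbing state \<open>q P f = q f \<le> f\<close> for every \<open>f\<close>, so excessiveness there is no condition.
\<close>

lemma minimal_absorbing_boundary:
  assumes "E \<subseteq> S" "\<And>x. x \<in> S - E \<Longrightarrow> p x x = 1"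
  shows "minimal_q_excessive q E S p = minimal_q_excessive q S S p"
proof -
  have "A f x \<le> f x" if "x \<in> S - E" for f x
    using absorbing_op[of x f] assms(2) that mult_right_mono[of q 1 "f x"] q_less_one by simp
  then have "q_excessive q E S p = q_excessive q S S p"
    using assms(1) unfolding q_excessive_def by blast
  then show ?thesis by (simp add: minimal_q_excessive_def)
qed

end

section \<open>Approaching an end of the state space\<close>

lemma eventually_to_right_end:
  assumes "S \<noteq> {}"
  shows "eventually P (to_right_end S) \<longleftrightarrow> (\<exists>z\<in>S. \<forall>y\<in>S. z \<le> y \<longrightarrow> P y)"
proof -
  have "\<exists>c\<in>S. principal {y \<in> S. c \<le> y} \<le> inf (principal {y \<in> S. a \<le> y}) (principal {y \<in> S. b \<le> y})"
    if "a \<in> S" "b \<in> S" for a b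
    using that by (intro bexI[of _ "max a b"]) (auto simp: max_def)
  then show ?thesis
    unfolding to_right_end_def
    by (subst eventually_INF_base) (use assms in \<open>auto simp: eventually_principal\<close>)
qed

lemma eventually_to_left_end:
  assumes "S \<noteq> {}"
  shows "eventually P (to_left_end S) \<longleftrightarrow> (\<exists>z\<in>S. \<forall>y\<in>S. y \<le> z \<longrightarrow> P y)"
proof -
  have "\<exists>c\<in>S. principal {y \<in> S. y \<le> c} \<le> inf (principal {y \<in> S. y \<le> a}) (principal {y \<in> S. y \<le> b})"
    if "a \<in> S" "b \<in> S" for a b
    using that by (intro bexI[of _ "min a b"]) (auto simp: min_def)
  then show ?thesis
    unfolding to_left_end_def
    by (subst eventually_INF_base) (use assms in \<open>auto simp: eventually_principal\<close>)
qed

lemma to_right_end_neq_bot: "S \<noteq> {} \<Longrightarrow> to_right_end S \<noteq> bot"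
  by (auto simp: trivial_limit_def eventually_to_right_end)

lemma to_left_end_neq_bot: "S \<noteq> {} \<Longrightarrow> to_left_end S \<noteq> bot"
  by (auto simp: trivial_limit_def eventually_to_left_end)

lemma antimono_on_tendsto_INF:
  fixes f :: "int \<Rightarrow> ennreal"
  assumes "S \<noteq> {}" "\<And>x y. x \<in> S \<Longrightarrow> y \<in> S \<Longrightarrow> x \<le> y \<Longrightarrow> f y \<le> f x"
  shows "(f \<longlongrightarrow> (INF x\<in>S. f x)) (to_right_end S)"
proof (rule order_tendstoI)
  fix a assume "a < (INF x\<in>S. f x)"
  then have "\<forall>y\<in>S. a < f y" by (auto dest: less_INF_D)
  then show "eventually (\<lambda>x. a < f x) (to_right_end S)"
    using assms(1) by (auto simp: eventually_to_right_end)
next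
  fix a assume "(INF x\<in>S. f x) < a"
  then obtain z where "z \<in> S" "f z < a" by (auto simp: INF_less_iff)
  then show "eventually (\<lambda>x. f x < a) (to_right_end S)"
    using assms by (subst eventually_to_right_end) (auto intro!: bexI[of _ z] intro: order.strict_trans1)
qed

context skip_free_kernel
begin

lemma martin_kernel_tendsto:
  assumes "x \<in> S" "ref \<in> S" "\<And>y. y \<in> S \<Longrightarrow> 0 < \<pi> y \<and> \<pi> y < top"
  shows "(martin_kernel S p \<pi> q ref x \<longlongrightarrow> extremal q S p ref x) (to_right_end S)"
proof (rule tendsto_eventually)
  show "\<forall>\<^sub>F y in to_right_end S. martin_kernel S p \<pi> q ref x y = extremal q S p ref x"
    using assms max_in[OF assms(1,2)]
    by (subst eventually_to_right_end)
      (auto intro!: bexI[of _ "max x ref"] martin_kernel_eq_extremal)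
qed

lemma martin_right_eq:
  assumes "x \<in> S" "ref \<in> S" "\<And>y. y \<in> S \<Longrightarrow> 0 < \<pi> y \<and> \<pi> y < top"
  shows "martin_right S p \<pi> q ref x = extremal q S p ref x"
  unfolding martin_right_def
  using martin_kernel_tendsto[OF assms] to_right_end_neq_bot[of S] assms(1)
  by (intro tendsto_Lim) auto

section \<open>Killing below a level\<close>

lemma killed_kernel: "skip_free_kernel (above S y) p q"
proof
  show "substochastic (above S y) p"
    by (rule substochastic_subset[OF substoch]) (auto simp: above_def)
next
  fix x z w assume "x \<in> above S y" "z \<in> above S y" "x \<le> w" "w \<le> z"
  then show "w \<in> above S y" using interval[of x z w] by (auto simp: above_def)
qed (auto simp: above_def up_pos skip_free q_pos q_less_one)

end

locale killed_below = skip_free_kernel +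
  fixes y ref ref' :: int
  assumes y: "y \<in> S" and ref: "ref \<in> S" and ref': "ref' \<in> above S y"
begin

abbreviation "T \<equiv> above S y"

sublocale killed: skip_free_kernel T p q
  by (rule killed_kernel)

abbreviation "H \<equiv> extremal q S p ref"
abbreviation "K \<equiv> extremal q T p ref'"

lemma above_states: "x \<in> T \<Longrightarrow> x \<in> S" "x \<in> T \<Longrightarrow> y < x"
  by (auto simp: above_def)

lemma H_neq: "x \<in> S \<Longrightarrow> H x \<noteq> 0" "x \<in> S \<Longrightarrow> H x \<noteq> top"
  using extremal_neq ref by auto

lemma K_neq: "x \<in> T \<Longrightarrow> K x \<noteq> 0" "x \<in> T \<Longrightarrow> K x \<noteq> top"
  using killed.extremal_neq ref' by auto

text \<open>
  The function \<open>\<phi> \<cdot> z\<close> of the full chain is superharmonic for the killed chain.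
\<close>

lemma killed_hitting_le:
  assumes "x \<in> T" "z \<in> T" "x \<le> z"
  shows "killed.\<phi> x z \<le> \<phi> x z"
proof -
  have "killed.\<phi> x z * \<phi> z z \<le> \<phi> x z"
  proof (rule killed.hitting_le_superharmonic[where f = "\<lambda>x. \<phi> x z"])
    show "killed.A (\<lambda>x. \<phi> x z) w \<le> \<phi> w z" for w
      by (rule order_trans[OF discounted_op_subset_le hitting_excessive]) (auto dest: above_states)
    show "\<phi> z z < top"
      by (intro hitting_finite above_states assms)
  qed (fact assms)+
  then show ?thesis using assms above_states[of z] by (simp add: hitting_self)
qed

text \<open>
  Either the passage from \<open>x\<close> to \<open>z\<close> stays above \<open>y\<close>, or it takes at least one step to enter
  \<open>{w. w \<le> y}\<close> and has to pass \<open>y\<close> afterwards.  The second contribution is dominated by the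
  superharmonic function \<open>\<phi> y z * v\<close>, where \<open>v\<close> is \<open>1\<close> at or below \<open>y\<close> and \<open>q\<close> above.
\<close>

lemma hitting_le_killed:
  assumes "x \<in> T" "z \<in> T" "x \<le> z"
  shows "\<phi> x z \<le> killed.\<phi> x z + q * \<phi> y z"
proof (cases "x = z")
  case False
  define k where "k = (\<lambda>x. if x \<in> T then killed.\<phi> x z else 0)"
  define v where "v = (\<lambda>x. if y < x then q else 1)"
  have z: "z \<in> S" "y < z" using assms above_states[of z] by auto
  have "\<phi> x z \<le> k x + \<phi> y z * v x"
  proof (rule comparison_principle[OF substoch q_less_one, where D = "{x \<in> S. y < x \<and> x < z}"
        and h = "\<lambda>_. 0" and u = "\<lambda>x. \<phi> x z" and f = "\<lambda>x. k x + \<phi> y z * v x" and M = 1])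
    fix w assume w: "w \<in> {x \<in> S. y < x \<and> x < z}"
    then have wT: "w \<in> T" by (simp add: above_def)
    \<comment> \<open>The function \<open>k\<close> is the killed passage kernel, extended by zero, so both operators agree on it.\<close>
    have "A k w = killed.A k w"
      by (rule discounted_op_subset) (auto simp: k_def above_def)
    also have "\<dots> = killed.A (\<lambda>x. killed.\<phi> x z) w"
      by (rule discounted_op_cong) (simp add: k_def)
    finally have "A k w \<le> k w"
      using killed.hitting_excessive[of z w] wT by (simp add: k_def)
    moreover have "A v w \<le> q * 1"
      using w q_less_one by (intro discounted_op_le_bound[OF substoch]) (auto simp: v_def)
    then have "A v w \<le> v w" using w by (simp add: v_def)
    ultimately show "0 + A (\<lambda>x. k x + \<phi> y z * v x) w \<le> k w + \<phi> y z * v w"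
      by (simp add: discounted_op_add discounted_op_cmult add_mono mult_left_mono)
    show "\<phi> w z \<le> 0 + A (\<lambda>x. \<phi> x z) w"
      using w by (simp add: hitting_harmonic)
    show "\<phi> w z \<le> 1"
      using w z hitting_le_one by simp
    fix x assume x: "x \<in> S" "x \<notin> {x \<in> S. y < x \<and> x < z}" "p w x \<noteq> 0"
    show "\<phi> x z \<le> k x + \<phi> y z * v x"
    proof (cases "x \<le> y")
      case True
      have "\<phi> x z \<le> \<phi> y z"
        using hitting_mult[of x y z] mult_right_mono[OF hitting_le_one[of x y], of "\<phi> y z"] x y z True
        by simp
      then show ?thesis using True by (simp add: v_def add_increasing)
    next
      case False
      then have "x = z" using exit_upwards[of w z x] w x by auto
      then show ?thesis
        using z by (simp add: k_def hitting_self assms(2) killed.hitting_self)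
    qed
  qed (use assms False in \<open>auto simp: above_def\<close>)
  then show ?thesis
    using assms above_states[of x] by (simp add: k_def v_def mult.commute)
qed (use assms above_states[of z] in \<open>simp add: hitting_self killed.hitting_self\<close>)

text \<open>
  Going up from \<open>x\<close> to \<open>z\<close> divides \<open>H\<close> by \<open>\<phi> x z\<close> and \<open>K\<close> by the smaller number \<open>killed.\<phi> x z\<close>.
\<close>

lemma ratio_antimono:
  assumes "x \<in> T" "z \<in> T" "x \<le> z"
  shows "H z / K z \<le> H x / K x"
proof -
  have "H z / K z = (H z * killed.\<phi> x z) / (K z * killed.\<phi> x z)"
    using killed.hitting_neq[OF assms] by (simp add: divide_mult_eq)
  also have "\<dots> \<le> (H z * \<phi> x z) / (K z * killed.\<phi> x z)"
    by (intro divide_right_mono_ennreal mult_left_mono killed_hitting_le assms) simp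
  also have "\<dots> = H x / K x"
    using extremal_hitting[of x ref z] killed.extremal_hitting[of x ref' z] assms ref ref' above_states[of x] above_states[of z]
    by (simp add: mult.commute)
  finally show ?thesis .
qed

definition "limit_ratio = (INF x\<in>T. H x / K x)"

lemma ratio_tendsto: "((\<lambda>x. H x / K x) \<longlongrightarrow> limit_ratio) (to_right_end T)"
  unfolding limit_ratio_def
  by (rule antimono_on_tendsto_INF) (use ref' ratio_antimono in auto)

lemma limit_ratio_less_top: "limit_ratio < top"
proof -
  have "limit_ratio \<le> H ref' / K ref'"
    unfolding limit_ratio_def using ref' by (rule INF_lower)
  also have "\<dots> < top"
    using H_neq[of ref'] K_neq[of ref'] ref' above_states[of ref'] by (auto simp: less_top[symmetric] ennreal_divide_eq_top_iff)
  finally show ?thesis .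
qed

lemma ratio_mult: "x \<in> T \<Longrightarrow> H x / K x * K x = H x"
  using K_neq[of x] by (simp add: ennreal_divide_times less_top)

lemma killed_le_full:
  assumes "x \<in> T"
  shows "limit_ratio * K x \<le> H x"
proof -
  have "limit_ratio * K x \<le> H x / K x * K x"
    unfolding limit_ratio_def using assms by (intro mult_right_mono INF_lower) auto
  then show ?thesis using ratio_mult[OF assms] by simp
qed

text \<open>
  The inequality \<open>hitting_le_killed\<close>, multiplied by \<open>H z\<close>, in the limit where \<open>z\<close> tends to the right
  end.
\<close>

lemma full_le_killed:
  assumes x: "x \<in> T"
  shows "H x \<le> limit_ratio * K x + q * H y"
proof -
  have bound: "H x \<le> K x * (H z / K z) + q * H y" if z: "z \<in> T" "x \<le> z" for z
  proof -
    have "H x = \<phi> x z * H z"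
      using extremal_hitting[of x ref z] z x ref above_states[of x] above_states[of z] by simp
    also have "\<dots> \<le> (killed.\<phi> x z + q * \<phi> y z) * H z"
      by (intro mult_right_mono hitting_le_killed x z) simp
    also have "\<dots> = killed.\<phi> x z * H z + q * H y"
      using extremal_hitting[of y ref z] z y ref above_states[of z] by (simp add: distrib_right mult.assoc)
    also have "killed.\<phi> x z * H z = killed.\<phi> x z * K z * (H z / K z)"
      using ratio_mult[OF z(1)] by (metis mult.assoc mult.commute)
    also have "killed.\<phi> x z * K z = K x"
      using killed.extremal_hitting[of x ref' z] x z ref' by simp
    finally show ?thesis .
  qed
  have "((\<lambda>z. K x * (H z / K z) + q * H y) \<longlongrightarrow> K x * limit_ratio + q * H y) (to_right_end T)"
    using K_neq[OF x] ratio_tendsto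
    by (intro tendsto_add tendsto_const ennreal_tendsto_cmult) (auto simp: less_top)
  moreover have "\<forall>\<^sub>F z in to_right_end T. H x \<le> K x * (H z / K z) + q * H y"
    using x bound by (subst eventually_to_right_end) auto
  moreover have "to_right_end T \<noteq> bot"
    using x by (intro to_right_end_neq_bot) auto
  ultimately have "H x \<le> K x * limit_ratio + q * H y"
    by (rule tendsto_lowerbound)
  then show ?thesis by (simp add: mult.commute)
qed

lemma q_mult_less: "c \<noteq> 0 \<Longrightarrow> c \<noteq> top \<Longrightarrow> q * c < c"
  using ennreal_mult_strict_right_mono[of q 1 c] q_less_one
  by (simp add: less_top zero_less_iff_neq_zero)

text \<open>
  A vanishing limit would give \<open>H \<le> q * H y\<close> above \<open>y\<close>, although \<open>H\<close> is increasing.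
\<close>

lemma limit_ratio_pos: "0 < limit_ratio"
proof (rule ccontr)
  assume "\<not> 0 < limit_ratio"
  then have "H ref' \<le> q * H y"
    using full_le_killed[OF ref'] by (simp add: zero_less_iff_neq_zero)
  also have "\<dots> < H y"
    using H_neq[OF y] by (rule q_mult_less)
  also have "\<dots> \<le> H ref'"
    using extremal_mono[of y ref ref'] y ref ref' above_states[of ref'] by simp
  finally show False by simp
qed

lemma limit_ratio_at_top:
  assumes "z \<in> T" "z + 1 \<notin> S"
  shows "limit_ratio * K z = H z"
proof -
  have "limit_ratio = H z / K z"
    unfolding limit_ratio_def
    using assms le_top_state[of z] above_states by (intro antisym INF_lower INF_greatest ratio_antimono) auto
  then show ?thesis using ratio_mult[OF assms(1)] by simp
qed

definition "killed_extremal x = (if x \<le> y then 0 else limit_ratio * K x)"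

lemma killed_extremal_le: "x \<in> S \<Longrightarrow> killed_extremal x \<le> H x"
  using killed_le_full[of x] by (auto simp: killed_extremal_def above_def)

lemma killed_extremal_harmonic:
  assumes "x \<in> S" "x + 1 \<in> S" "x \<noteq> y"
  shows "A killed_extremal x = killed_extremal x"
proof (cases "x < y")
  case True
  have "A killed_extremal x = A (\<lambda>z. 0 * 0) x"
    using skip_free[of x] assms True by (intro discounted_op_cong) (force simp: killed_extremal_def)
  then show ?thesis
    using True by (subst (asm) discounted_op_cmult) (simp add: killed_extremal_def)
next
  case False
  then have x: "x \<in> T" "x + 1 \<in> T" using assms by (auto simp: above_def)
  have "A killed_extremal x = killed.A killed_extremal x"
    by (rule discounted_op_subset) (auto simp: above_def killed_extremal_def)
  also have "\<dots> = killed.A (\<lambda>z. limit_ratio * K z) x"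
    by (rule discounted_op_cong) (auto simp: above_def killed_extremal_def)
  also have "\<dots> = killed_extremal x"
    using killed.extremal_harmonic[OF x(1) ref' x(2)] False assms
    by (simp add: discounted_op_cmult killed_extremal_def)
  finally show ?thesis .
qed

text \<open>
  Both sides are bounded and harmonic off \<open>y\<close> below the top, and they agree at the exits of that
  region: at \<open>y\<close>, where both are \<open>H y\<close>, and at an absorbing top, where both vanish.  Boundedness of the
  left side is where \<open>full_le_killed\<close> enters, as \<open>H\<close> itself may be unbounded.
\<close>

theorem full_minus_killed:
  assumes top_absorbing: "\<And>x. x \<in> S \<Longrightarrow> x + 1 \<notin> S \<Longrightarrow> p x x = 1"
    and "y + 1 \<in> S" and x: "x \<in> S"
  shows "H x - killed_extremal x = \<phi> x y * H y"
proof -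
  define w where "w = (\<lambda>x. H x - killed_extremal x)"
  define v where "v = (\<lambda>x. \<phi> x y * H y)"
  define D where "D = {x \<in> S. x + 1 \<in> S \<and> x \<noteq> y}"
  have ke_fin: "killed_extremal x \<noteq> top" if "x \<in> S" for x
    using killed_extremal_le[OF that] H_neq[OF that] by (auto simp: top_unique)
  have split: "H x = killed_extremal x + w x" if "x \<in> S" for x
    using killed_extremal_le[OF that] by (simp add: w_def add_diff_inverse_ennreal)
  have w_le: "w x \<le> H y" if "x \<in> S" for x
  proof (cases "x \<le> y")
    case True
    then show ?thesis
      using extremal_mono[of x ref y] that y ref by (simp add: w_def killed_extremal_def)
  next
    case False
    then have "killed_extremal x + w x \<le> killed_extremal x + q * H y"
      using full_le_killed[of x] that split[OF that] by (simp add: above_def killed_extremal_def)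
    then have "w x \<le> q * H y"
      using ke_fin[OF that] by (auto simp: ennreal_add_left_cancel_le)
    also have "\<dots> \<le> H y"
      using q_mult_less[OF H_neq[OF y]] by simp
    finally show ?thesis .
  qed
  have v_le: "v x \<le> H y" if "x \<in> S" for x
    using mult_right_mono[OF hitting_le_one[OF that y], of "H y"] by (simp add: v_def)
  have w_harm: "A w x = w x" if "x \<in> D" for x
  proof -
    have xS: "x \<in> S" "x + 1 \<in> S" "x \<noteq> y" using that by (auto simp: D_def)
    have "killed_extremal x + A w x = A killed_extremal x + A w x"
      by (simp add: killed_extremal_harmonic xS)
    also have "\<dots> = A H x"
      unfolding discounted_op_add[symmetric] by (rule discounted_op_cong) (simp add: split)
    also have "\<dots> = killed_extremal x + w x"
      by (simp add: extremal_harmonic xS ref split)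
    finally show ?thesis
      using ke_fin[OF xS(1)] by (auto simp: ennreal_add_left_cancel)
  qed
  have v_harm: "A v x = v x" if "x \<in> D" for x
    using that discounted_op_cmult[of q S p "H y" "\<lambda>x. \<phi> x y" x] hitting_harmonic[of x y]
    by (simp add: v_def D_def mult.commute)
  have boundary: "w z = v z" if z: "z \<in> S" "z \<notin> D" for z
  proof (cases "z = y")
    case True
    then show ?thesis by (simp add: w_def v_def killed_extremal_def hitting_self y)
  next
    case False
    then have top: "z + 1 \<notin> S" using z by (simp add: D_def)
    then have "z \<in> T" using le_top_state[OF z(1) _ y] False z by (simp add: above_def)
    then have "w z = 0"
      using limit_ratio_at_top[OF _ top] by (auto simp: w_def killed_extremal_def above_def diff_eq_0_iff_ennreal H_neq less_top)
    \<comment> \<open>From the absorbing top \<open>y\<close> is never reached; analytically, \<open>\<phi> z y = q * \<phi> z y\<close>.\<close>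
    moreover have "\<phi> z y = q * \<phi> z y"
      using hitting_harmonic[OF False] absorbing_op[OF z(1) top_absorbing[OF z(1) top]] by metis
    then have "\<phi> z y = 0"
      using q_mult_less[of "\<phi> z y"] hitting_finite[OF z(1) y] by force
    ultimately show ?thesis by (simp add: v_def)
  qed
  have fin: "H y < top" using H_neq[OF y] by (simp add: less_top)
  have "w x = v x"
  proof (cases "x \<in> D")
    case True
    show ?thesis
    proof (rule antisym)
      show "w x \<le> v x"
        by (rule comparison_principle[OF substoch q_less_one, where D = D and h = "\<lambda>_. 0"
              and M = "H y"]) (use True w_harm v_harm w_le boundary fin in \<open>auto simp: D_def\<close>)
      show "v x \<le> w x"
        by (rule comparison_principle[OF substoch q_less_one, where D = D and h = "\<lambda>_. 0"
              and M = "H y"]) (use True w_harm v_harm v_le boundary fin in \<open>auto simp: D_def\<close>)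
    qed
  qed (use boundary x in simp)
  then show ?thesis by (simp add: w_def v_def)
qed

end

section \<open>Limit ratios and the killed harmonic function\<close>

lemma unique_on_normalized:
  assumes "\<And>f. P f \<longleftrightarrow> (\<exists>c\<in>C. \<forall>x\<in>S. f x = c * e x)"
    and "ref \<in> S" "e ref = 1" "1 \<in> C" "\<And>x. x \<in> S \<Longrightarrow> h x = e x"
  shows "unique_on S (\<lambda>f. P f \<and> f ref = 1) h"
  unfolding unique_on_def using assms by (fastforce intro: bexI[of _ 1])

context killed_below
begin

lemma eventually_in_T: "eventually (\<lambda>x. x \<in> T) (to_right_end T)"
  using ref' by (subst eventually_to_right_end) auto

lemma T_end_neq_bot: "to_right_end T \<noteq> bot"
  using ref' by (intro to_right_end_neq_bot) auto

lemma kappa_ratio_eq: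
  assumes "\<And>y. y \<in> S \<Longrightarrow> 0 < \<pi> y \<and> \<pi> y < top" "x \<in> T"
  shows "kappa_ratio S p \<pi> q ref ref' y x = H x / K x"
proof -
  have "martin_right S p \<pi> q ref x = H x"
    by (rule martin_right_eq) (use assms above_states(1)[OF assms(2)] ref in auto)
  moreover have "martin_right T p \<pi> q ref' x = K x"
    by (rule killed.martin_right_eq) (use assms(1)[OF above_states(1)] assms(2) ref' in auto)
  ultimately show ?thesis by (simp add: kappa_ratio_def)
qed

lemma kappa_ratio_tendsto:
  assumes "\<And>y. y \<in> S \<Longrightarrow> 0 < \<pi> y \<and> \<pi> y < top"
  shows "(kappa_ratio S p \<pi> q ref ref' y \<longlongrightarrow> limit_ratio) (to_right_end T)"
  by (rule Lim_transform_eventually[OF ratio_tendsto])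
    (use eventually_in_T in \<open>rule eventually_mono; simp add: kappa_ratio_eq[OF assms]\<close>)

lemma kappa_eq:
  assumes "\<And>y. y \<in> S \<Longrightarrow> 0 < \<pi> y \<and> \<pi> y < top"
  shows "kappa S p \<pi> q ref ref' y = limit_ratio"
  unfolding kappa_def by (rule tendsto_Lim[OF T_end_neq_bot kappa_ratio_tendsto[OF assms]])

lemma killed_H_eq:
  assumes "\<And>y. y \<in> S \<Longrightarrow> 0 < \<pi> y \<and> \<pi> y < top" "x \<in> S"
  shows "killed_H S p \<pi> q ref ref' y x = killed_extremal x"
proof (cases "x \<le> y")
  case False
  then have "x \<in> T" using assms(2) by (simp add: above_def)
  then have "martin_right T p \<pi> q ref' x = K x"
    by (rule killed.martin_right_eq) (use assms(1)[OF above_states(1)] ref' in auto)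
  then show ?thesis
    using False by (simp add: killed_H_def killed_extremal_def kappa_eq[OF assms(1)])
qed (simp add: killed_H_def killed_extremal_def)

text \<open>
  The normalization at the right end selects one multiple of \<open>K\<close>.
\<close>

lemma killed_asymptotics:
  assumes "\<And>x. x \<in> T \<Longrightarrow> f x = c * K x" "c < top" "\<And>x. x \<in> T \<Longrightarrow> h x = H x"
  shows "((\<lambda>x. f x / h x) \<longlongrightarrow> 1) (to_right_end T) \<longleftrightarrow> c = limit_ratio"
proof -
  have "((\<lambda>x. c * inverse (H x / K x)) \<longlongrightarrow> c * inverse limit_ratio) (to_right_end T)"
    using ratio_tendsto assms(2)
    by (intro ennreal_tendsto_cmult continuous_on_tendsto_compose[where f = inverse and s = UNIV]
        continuous_on_inverse_ennreal continuous_on_id) auto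
  moreover have "c * inverse (H x / K x) = f x / h x" if "x \<in> T" for x
    using K_neq[OF that] H_neq[of x] above_states[OF that] assms(1,3)[OF that]
      one_divide_one_divide_ennreal[of "K x"]
    by (simp add: divide_ennreal_def ennreal_inverse_mult' mult.assoc mult.left_commute mult.commute
        zero_less_iff_neq_zero)
  then have "\<forall>\<^sub>F x in to_right_end T. c * inverse (H x / K x) = f x / h x"
    using eventually_in_T by (auto elim: eventually_mono)
  ultimately have lim: "((\<lambda>x. f x / h x) \<longlongrightarrow> c / limit_ratio) (to_right_end T)"
    unfolding divide_ennreal_def[of c] by (rule Lim_transform_eventually)
  have "((\<lambda>x. f x / h x) \<longlongrightarrow> 1) (to_right_end T) \<longleftrightarrow> c / limit_ratio = 1"
    using lim tendsto_unique[OF T_end_neq_bot] by metis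
  then show ?thesis
    using limit_ratio_pos limit_ratio_less_top by (auto simp: divide_eq_1_ennreal)
qed

lemma killed_unique:
  assumes "\<And>f. P f \<longleftrightarrow> (\<exists>c\<in>C. \<forall>x\<in>T. f x = c * K x)"
    and "\<And>c. c \<in> C \<Longrightarrow> c < top" "limit_ratio \<in> C"
    and "\<And>x. x \<in> T \<Longrightarrow> h x = H x" "\<And>x. x \<in> T \<Longrightarrow> k x = killed_extremal x"
  shows "unique_on T (\<lambda>f. P f \<and> ((\<lambda>x. f x / h x) \<longlongrightarrow> 1) (to_right_end T)) k"
proof -
  have k: "k x = limit_ratio * K x" if "x \<in> T" for x
    using assms(5)[OF that] above_states[OF that] by (simp add: killed_extremal_def)
  have "P k" using assms(1,3) k by blast
  moreover have "((\<lambda>x. k x / h x) \<longlongrightarrow> 1) (to_right_end T)"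
    using killed_asymptotics[OF k limit_ratio_less_top assms(4)] by simp
  moreover have "f x = k x" if "P f" "((\<lambda>x. f x / h x) \<longlongrightarrow> 1) (to_right_end T)" "x \<in> T" for f x
  proof -
    from that(1) obtain c where c: "c \<in> C" "\<forall>x\<in>T. f x = c * K x"
      unfolding assms(1) ..
    then have "c = limit_ratio"
      using killed_asymptotics[OF _ assms(2)[OF c(1)] assms(4), of f] that(2) by simp
    then show ?thesis using k that(3) c(2) by simp
  qed
  ultimately show ?thesis unfolding unique_on_def by blast
qed

end

section \<open>The dual matrix\<close>

text \<open>
  Transition powers are defined by conditioning on the first step; transposition turns the last step
  of the chain into the first step of its dual.
\<close>

lemma chapman_kolmogorov_last:
  assumes "x \<in> S" "y \<in> S"
  shows "transition_power S p (Suc n) x y = (\<integral>\<^sup>+ z. transition_power S p n x z * p z y \<partial>count_space S)"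
  using assms(1)
proof (induction n arbitrary: x)
  case 0
  have "(\<integral>\<^sup>+ z. p x z * (if z = y then 1 else 0) \<partial>count_space S)
      = (\<integral>\<^sup>+ z. p x z * (if z = y then 1 else 0) \<partial>count_space {y})"
    by (rule nn_integral_count_space_eq) (use assms(2) in auto)
  moreover have "(\<integral>\<^sup>+ z. (if x = z then 1 else 0) * p z y \<partial>count_space S)
      = (\<integral>\<^sup>+ z. (if x = z then 1 else 0) * p z y \<partial>count_space {x})"
    by (rule nn_integral_count_space_eq) (use 0 in auto)
  ultimately show ?case by (simp add: nn_integral_count_space_finite)
next
  case (Suc n)
  have "transition_power S p (Suc (Suc n)) x y
      = (\<integral>\<^sup>+ z. p x z * (\<integral>\<^sup>+ w. transition_power S p n z w * p w y \<partial>count_space S) \<partial>count_space S)"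
    unfolding transition_power.simps(2)[of S p "Suc n"]
    by (intro nn_integral_cong) (simp only: Suc.IH space_count_space)
  also have "\<dots> = (\<integral>\<^sup>+ z. \<integral>\<^sup>+ w. p x z * transition_power S p n z w * p w y \<partial>count_space S \<partial>count_space S)"
    by (simp add: nn_integral_cmult mult.assoc)
  also have "\<dots> = (\<integral>\<^sup>+ w. \<integral>\<^sup>+ z. p x z * transition_power S p n z w * p w y \<partial>count_space S \<partial>count_space S)"
    by (rule nn_integral_count_space_nn_integral) auto
  also have "\<dots> = (\<integral>\<^sup>+ w. transition_power S p (Suc n) x w * p w y \<partial>count_space S)"
    by (simp add: nn_integral_multc)
  finally show ?case .
qed

lemma transition_power_dual:
  assumes "\<And>x. x \<in> E \<Longrightarrow> 0 < \<pi> x \<and> \<pi> x < top" "x \<in> E" "y \<in> E"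
  shows "transition_power E (dual_matrix p \<pi>) n y x = transition_power E p n x y * \<pi> x / \<pi> y"
  using assms(3)
proof (induction n arbitrary: y)
  case 0
  then show ?case using assms(1)[of x] assms(2) by (auto simp: ennreal_divide_self)
next
  case (Suc n)
  have "transition_power E (dual_matrix p \<pi>) (Suc n) y x
      = (\<integral>\<^sup>+ z. transition_power E p n x z * p z y * (\<pi> x / \<pi> y) \<partial>count_space E)"
    unfolding transition_power.simps(2)
  proof (rule nn_integral_cong)
    fix z assume "z \<in> space (count_space E)"
    then have z: "z \<in> E" by simp
    have "dual_matrix p \<pi> y z * transition_power E (dual_matrix p \<pi>) n z x
        = (transition_power E p n x z * p z y * (\<pi> x / \<pi> y)) * (\<pi> z / \<pi> z)"
      by (simp add: Suc.IH[OF z] dual_matrix_def divide_ennreal_def mult_ac)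
    also have "\<pi> z / \<pi> z = 1"
      using assms(1)[OF z] by (intro ennreal_divide_self) auto
    finally show "dual_matrix p \<pi> y z * transition_power E (dual_matrix p \<pi>) n z x
        = transition_power E p n x z * p z y * (\<pi> x / \<pi> y)" by simp
  qed
  also have "\<dots> = transition_power E p (Suc n) x y * (\<pi> x / \<pi> y)"
    unfolding chapman_kolmogorov_last[OF assms(2) Suc.prems] by (rule nn_integral_multc) simp
  finally show ?case by (simp add: ennreal_times_divide)
qed

text \<open>
  Transition powers of the dual are transposed up to \<open>\<pi> x / \<pi> y\<close>, and the normalization by the
  reference measure removes this factor.
\<close>

lemma potential_kernel_dual:
  assumes "\<And>x. x \<in> E \<Longrightarrow> 0 < \<pi> x \<and> \<pi> x < top" "x \<in> E" "y \<in> E"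
  shows "potential_kernel E (dual_matrix p \<pi>) \<pi> q y x = potential_kernel E p \<pi> q x y"
proof -
  have "\<pi> x / \<pi> x = 1"
    using assms(1)[OF assms(2)] by (intro ennreal_divide_self) auto
  moreover have "a * \<pi> x / \<pi> y / \<pi> x = a / \<pi> y * (\<pi> x / \<pi> x)" for a
    by (simp add: divide_ennreal_def mult_ac)
  ultimately show ?thesis
    by (simp add: potential_kernel_def transition_power_dual[OF assms])
qed

lemma dual_substochastic:
  assumes "\<And>x. x \<in> E \<Longrightarrow> 0 < \<pi> x \<and> \<pi> x < top"
    and "\<And>y. y \<in> E \<Longrightarrow> (\<integral>\<^sup>+ x. \<pi> x * p x y \<partial>count_space E) \<le> \<pi> y"
  shows "substochastic E (dual_matrix p \<pi>)"
  unfolding substochastic_def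
proof
  fix y assume y: "y \<in> E"
  have "(\<integral>\<^sup>+ x. dual_matrix p \<pi> y x \<partial>count_space E) = (\<integral>\<^sup>+ x. \<pi> x * p x y / \<pi> y \<partial>count_space E)"
    by (simp add: dual_matrix_def mult.commute)
  also have "\<dots> = (\<integral>\<^sup>+ x. \<pi> x * p x y \<partial>count_space E) / \<pi> y"
    by (simp add: nn_integral_divide)
  also have "\<dots> \<le> \<pi> y / \<pi> y"
    by (intro divide_right_mono_ennreal assms(2) y)
  also have "\<dots> = 1"
    using assms(1)[OF y] by (intro ennreal_divide_self) auto
  finally show "(\<integral>\<^sup>+ x. dual_matrix p \<pi> y x \<partial>count_space E) \<le> 1" .
qed

section \<open>Reflection of the integers\<close>

definition reflect :: "(int \<Rightarrow> int \<Rightarrow> ennreal) \<Rightarrow> int \<Rightarrow> int \<Rightarrow> ennreal" where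
  "reflect P x y = P (- x) (- y)"

lemma reflect_reflect: "reflect (reflect P) = P"
  by (simp add: reflect_def fun_eq_iff)

lemma nn_integral_reflect:
  "(\<integral>\<^sup>+ x. f x \<partial>count_space (uminus ` E)) = (\<integral>\<^sup>+ x. f (- x) \<partial>count_space (E :: int set))"
  by (rule nn_integral_bij_count_space[symmetric]) (auto simp: bij_betw_def)

lemma discounted_op_reflect:
  "discounted_op q (uminus ` E) (reflect P) f x = discounted_op q E P (\<lambda>z. f (- z)) (- x)"
  by (simp add: discounted_op_def reflect_def nn_integral_reflect)

lemma transition_power_reflect:
  "transition_power (uminus ` E) (reflect P) n x y = transition_power E P n (- x) (- y)"
  by (induction n arbitrary: x) (auto simp: reflect_def nn_integral_reflect)

lemma potential_kernel_reflect:
  "potential_kernel (uminus ` E) (reflect P) (\<lambda>x. \<pi> (- x)) q x y = potential_kernel E P \<pi> q (- x) (- y)"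
  by (simp add: potential_kernel_def transition_power_reflect)

lemma q_excessive_reflect:
  "f \<in> q_excessive q (uminus ` E) (uminus ` E) (reflect P) \<longleftrightarrow> (\<lambda>x. f (- x)) \<in> q_excessive q E E P"
  by (simp add: q_excessive_def discounted_op_reflect)

text \<open>
  Reflection is an involution, so the converse follows by a second application.
\<close>

lemma minimal_q_excessive_reflect_imp:
  assumes "f \<in> minimal_q_excessive q (uminus ` E) (uminus ` E) (reflect P)"
  shows "(\<lambda>x. f (- x)) \<in> minimal_q_excessive q E E P"
proof -
  have f: "f \<in> q_excessive q (uminus ` E) (uminus ` E) (reflect P)" "\<exists>x\<in>E. f (- x) \<noteq> 0"
    using assms by (auto simp: minimal_q_excessive_def)
  have "(\<exists>c<top. \<forall>x\<in>E. f1 x = c * f (- x))"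
    if "f1 \<in> q_excessive q E E P" "f2 \<in> q_excessive q E E P" "\<forall>x\<in>E. f (- x) = f1 x + f2 x" for f1 f2
  proof -
    have "\<exists>d<top. \<forall>x\<in>uminus ` E. f1 (- x) = d * f x"
      using that by (intro minimal_q_excessiveD[OF assms, where ?f1.0 = "\<lambda>x. f1 (- x)" and ?f2.0 = "\<lambda>x. f2 (- x)"])
        (auto simp: q_excessive_reflect)
    then show ?thesis by auto
  qed
  note * = this
  have "(\<exists>c<top. \<forall>x\<in>E. f1 x = c * f (- x)) \<and> (\<exists>c<top. \<forall>x\<in>E. f2 x = c * f (- x))"
    if "f1 \<in> q_excessive q E E P" "f2 \<in> q_excessive q E E P" "\<forall>x\<in>E. f (- x) = f1 x + f2 x" for f1 f2
    using *[of f1 f2] *[of f2 f1] that by (simp add: add.commute)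
  with f show ?thesis
    unfolding minimal_q_excessive_def by (simp add: q_excessive_reflect)
qed

lemma minimal_q_excessive_reflect:
  "f \<in> minimal_q_excessive q E E P \<longleftrightarrow>
    (\<lambda>x. f (- x)) \<in> minimal_q_excessive q (uminus ` E) (uminus ` E) (reflect P)"
  using minimal_q_excessive_reflect_imp[of "\<lambda>x. f (- x)" q E P]
    minimal_q_excessive_reflect_imp[of f q "uminus ` E" "reflect P"]
  by (auto simp: image_image reflect_reflect)

section \<open>A chain together with its dual\<close>

lemma transition_power_from_absorbing:
  assumes "\<And>z. z \<in> S \<Longrightarrow> z \<noteq> x \<Longrightarrow> p x z = 0" "x \<noteq> y"
  shows "transition_power S p n x y = 0"
proof (induction n)
  case (Suc n)
  have "p x z * transition_power S p n z y = 0" if "z \<in> S" for z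
    using Suc assms(1)[OF that] by (cases "z = x") auto
  then have "transition_power S p (Suc n) x y = (\<integral>\<^sup>+ z. 0 \<partial>count_space S)"
    unfolding transition_power.simps(2) by (intro nn_integral_cong) simp
  then show ?case by simp
qed (simp add: assms)

text \<open>
  A path that leaves \<open>E\<close> stays at the state where it left, so paths between states of \<open>E\<close> never leave
  \<open>E\<close>.
\<close>

lemma transition_power_restrict:
  assumes "E \<subseteq> S" "\<And>x z. x \<in> S - E \<Longrightarrow> z \<in> S \<Longrightarrow> z \<noteq> x \<Longrightarrow> p x z = 0" "x \<in> E" "y \<in> E"
  shows "transition_power S p n x y = transition_power E p n x y"
  using assms(3)
proof (induction n arbitrary: x)
  case (Suc n)
  have "transition_power S p n z y = 0" if "z \<in> S - E" for z
    using that assms by (intro transition_power_from_absorbing) auto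
  then have "transition_power S p (Suc n) x y = (\<integral>\<^sup>+ z. p x z * transition_power S p n z y \<partial>count_space E)"
    unfolding transition_power.simps(2) by (intro nn_integral_count_space_eq) (use assms(1) in auto)
  also have "\<dots> = transition_power E p (Suc n) x y"
    unfolding transition_power.simps(2) by (intro nn_integral_cong) (simp add: Suc.IH)
  finally show ?case .
qed simp

text \<open>
  A chain of the class \<open>\<M>\<^sub>\<infinity>\<close> without reference to the endpoints: \<open>S - E\<close> consists of the greatest
  element of \<open>S\<close>, if there is one, and it is absorbing.
\<close>

locale chain_with_dual = skip_free_kernel +
  fixes E :: "int set" and \<pi> :: "int \<Rightarrow> ennreal" and ref :: int
  assumes E_eq: "E = {x \<in> S. x + 1 \<in> S}"
    and absorbing: "x \<in> S \<Longrightarrow> x \<notin> E \<Longrightarrow> p x x = 1"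
    and \<pi>_pos: "x \<in> S \<Longrightarrow> 0 < \<pi> x \<and> \<pi> x < top"
    and \<pi>_excessive: "y \<in> E \<Longrightarrow> (\<integral>\<^sup>+ x. \<pi> x * p x y \<partial>count_space E) \<le> \<pi> y"
    and ref: "ref \<in> E"
begin

abbreviation "R \<equiv> uminus ` E"
abbreviation "P' \<equiv> dual_matrix p \<pi>"
abbreviation "H \<equiv> extremal q S p ref"

lemma E_subset: "E \<subseteq> S"
  by (auto simp: E_eq)

lemma ref_S: "ref \<in> S"
  using ref E_subset by auto

lemma \<pi>_E: "x \<in> E \<Longrightarrow> 0 < \<pi> x \<and> \<pi> x < top"
  using \<pi>_pos E_subset by auto

lemma E_interval: "x \<in> E \<Longrightarrow> y \<in> E \<Longrightarrow> x \<le> z \<Longrightarrow> z \<le> y \<Longrightarrow> z \<in> E"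
  using interval[of x y z] interval[of x "y + 1" "z + 1"] by (auto simp: E_eq)

text \<open>
  The dual chain can go down by one step only, so its reflection is upward skip-free; it is
  substochastic because \<open>\<pi>\<close> is excessive.
\<close>

lemma reflected_kernel: "skip_free_kernel R (reflect P') q"
proof
  show "z \<in> R" if "x \<in> R" "y \<in> R" "x \<le> z" "z \<le> y" for x y z
    using E_interval[of "- y" "- x" "- z"] that by force
  show "substochastic R (reflect P')"
    using dual_substochastic[of E \<pi> p, OF \<pi>_E \<pi>_excessive]
    by (simp add: substochastic_def nn_integral_reflect reflect_def)
  show "0 < reflect P' x (x + 1)" if "x \<in> R" "x + 1 \<in> R" for x
  proof -
    have "- (x + 1) \<in> E" using that(2) by force
    then have x: "- x \<in> E" "- x - 1 \<in> E" using that(1) by auto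
    then have "0 < p (- x - 1) (- x)"
      using up_pos[of "- x - 1"] E_subset by auto
    then show ?thesis
      using \<pi>_E[OF x(1)] \<pi>_E[OF x(2)]
      by (simp add: reflect_def dual_matrix_def ennreal_zero_less_divide ennreal_zero_less_mult_iff)
  qed
  show "reflect P' x y = 0" if "x \<in> R" "y \<in> R" "x + 1 < y" for x y
    using skip_free[of "- y" "- x"] that E_subset
    by (force simp: reflect_def dual_matrix_def)
qed (use q_pos q_less_one in auto)

sublocale reflected: skip_free_kernel R "reflect P'" q
  by (rule reflected_kernel)

text \<open>
  The function \<open>H\<close> of the reflected dual chain, carried back to \<open>E\<close>.
\<close>

definition "dual_extremal x = extremal q R (reflect P') (- ref) (- x)"

lemma dual_martin_kernel_eq:
  assumes "x \<in> E" "y \<in> E" "y \<le> x" "y \<le> ref"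
  shows "martin_kernel E P' \<pi> q ref x y = dual_extremal x"
proof -
  have "martin_kernel R (reflect P') (\<lambda>x. \<pi> (- x)) q (- ref) (- x) (- y)
      = extremal q R (reflect P') (- ref) (- x)"
    using assms ref \<pi>_E[of y] by (intro reflected.martin_kernel_eq_extremal) auto
  then show ?thesis
    by (simp add: martin_kernel_def potential_kernel_reflect dual_extremal_def)
qed

lemma dual_martin_kernel_tendsto:
  assumes "x \<in> E"
  shows "(martin_kernel E P' \<pi> q ref x \<longlongrightarrow> dual_extremal x) (to_left_end E)"
proof (rule tendsto_eventually)
  show "\<forall>\<^sub>F y in to_left_end E. martin_kernel E P' \<pi> q ref x y = dual_extremal x"
    using assms ref min_def[of x ref]
    by (subst eventually_to_left_end)
      (auto intro!: bexI[of _ "min x ref"] dual_martin_kernel_eq)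
qed

lemma martin_left_eq:
  assumes "x \<in> E"
  shows "martin_left E P' \<pi> q ref x = dual_extremal x"
  unfolding martin_left_def
  using dual_martin_kernel_tendsto[OF assms] to_left_end_neq_bot[of E] assms
  by (intro tendsto_Lim) auto

lemma minimal_decreasing_iff:
  "f \<in> minimal_q_excessive q E E P' \<and> antimono_on E f \<longleftrightarrow>
    (\<exists>c\<in>{0<..<top}. \<forall>x\<in>E. f x = c * dual_extremal x)"
proof -
  have "antimono_on E f \<longleftrightarrow> mono_on R (\<lambda>x. f (- x))"
    by (auto simp: monotone_on_def)
  then show ?thesis
    using reflected.minimal_increasing_iff[of "- ref" "\<lambda>x. f (- x)"] ref
    by (auto simp: minimal_q_excessive_reflect[of f] dual_extremal_def)
qed

lemma potential_kernel_restrict: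
  assumes "x \<in> E" "y \<in> E"
  shows "potential_kernel S p \<pi> q x y = potential_kernel E p \<pi> q x y"
proof -
  have "transition_power S p n x y = transition_power E p n x y" for n
    by (rule transition_power_restrict[OF E_subset _ assms])
      (use absorbing absorbing_row in blast)
  then show ?thesis by (simp add: potential_kernel_def)
qed

text \<open>
  Evaluated at a common lower state \<open>z\<close>, the dual Martin kernel is
  \<open>\<phi> z y * (g y y / \<pi> y) / (\<phi> z ref * (g ref ref / \<pi> ref))\<close>, and \<open>\<phi> z y * H y = H z = \<phi> z ref\<close>.
\<close>

lemma diagonal_factorization:
  assumes y: "y \<in> E"
  shows "potential_kernel S p \<pi> q ref ref * dual_extremal y * H y = g y y / \<pi> y"
proof -
  define z where "z = min y ref"
  have z: "z \<in> E" "z \<le> y" "z \<le> ref" using y ref by (auto simp: z_def min_def)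
  have S: "y \<in> S" "ref \<in> S" "z \<in> S" using y z ref E_subset by auto
  define a where "a = \<phi> z ref * (g ref ref / \<pi> ref)"
  define b where "b = g y y / \<pi> y"
  have Hz: "\<phi> z y * H y = \<phi> z ref"
    using extremal_hitting[of z ref y] extremal_hitting[of z ref ref] extremal_ref S z by simp
  have "g ref ref / \<pi> ref \<noteq> 0" "g ref ref / \<pi> ref \<noteq> top"
    using green_diag_neq[OF S(2)] \<pi>_pos[OF S(2)] by (auto simp: ennreal_divide_eq_top_iff)
  note c = this
  note phi = hitting_neq[OF S(3,2) z(3)]
  have "dual_extremal y = potential_kernel E P' \<pi> q y z / potential_kernel E P' \<pi> q ref z"
    using dual_martin_kernel_eq[OF y z] by (simp add: martin_kernel_def)
  also have "\<dots> = potential_kernel S p \<pi> q z y / potential_kernel S p \<pi> q z ref"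
    using y ref z \<pi>_E by (simp add: potential_kernel_dual potential_kernel_restrict)
  also have "\<dots> = \<phi> z y * b / a"
    unfolding potential_kernel_eq_green green_eq_hitting[OF S(1), of z] green_eq_hitting[OF S(2), of z]
    by (simp add: a_def b_def ennreal_times_divide)
  finally have d: "dual_extremal y = \<phi> z y * b / a" .
  have "potential_kernel S p \<pi> q ref ref * dual_extremal y * H y
      = (b * (\<phi> z y * H y) * (g ref ref / \<pi> ref)) / a"
    unfolding d potential_kernel_eq_green by (simp add: ennreal_times_divide divide_ennreal_def mult_ac)
  also have "\<dots> = b * a / a"
    unfolding Hz a_def by (simp add: mult.assoc)
  also have "\<dots> = b"
    using c phi by (intro ennreal_mult_divide_eq) (auto simp: a_def ennreal_mult_eq_top_iff)
  finally show ?thesis by (simp add: b_def)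
qed

lemma potential_kernel_ref_bounds: "0 < potential_kernel S p \<pi> q ref ref" "potential_kernel S p \<pi> q ref ref < top"
  using green_diag_neq[OF ref_S] \<pi>_pos[OF ref_S]
  by (auto simp: potential_kernel_eq_green ennreal_zero_less_divide less_top[symmetric]
      ennreal_divide_eq_top_iff zero_less_iff_neq_zero)

lemma minimal_iff:
  "f \<in> minimal_q_excessive q E S p \<and> mono_on S f \<longleftrightarrow> (\<exists>c\<in>{0<..<top}. \<forall>x\<in>S. f x = c * H x)"
  using minimal_increasing_iff[OF ref_S, of f] minimal_absorbing_boundary[OF E_subset] absorbing
  by auto

lemma martin_right_extremal: "x \<in> S \<Longrightarrow> martin_right S p \<pi> q ref x = H x"
  using martin_right_eq ref_S \<pi>_pos by blast

theorem unique_minimal_increasing: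
  "unique_on S (\<lambda>f. f \<in> minimal_q_excessive q E S p \<and> mono_on S f \<and> f ref = 1)
    (martin_right S p \<pi> q ref)"
  unfolding conj_assoc[symmetric]
  by (rule unique_on_normalized[OF minimal_iff ref_S])
    (auto simp: extremal_ref ref_S martin_right_extremal)

theorem unique_increasing_harmonic:
  "unique_on S (\<lambda>f. f \<in> q_harmonic q E S p \<and> mono_on S f \<and> f ref = 1) (martin_right S p \<pi> q ref)"
proof -
  have "f \<in> q_harmonic q E S p \<and> mono_on S f \<longleftrightarrow> (\<exists>c\<in>{..<top}. \<forall>x\<in>S. f x = c * H x)" for f
    using increasing_harmonic_iff[OF ref_S E_eq, of f] by auto
  from unique_on_normalized[OF this ref_S] show ?thesis
    unfolding conj_assoc[symmetric] by (auto simp: extremal_ref ref_S martin_right_extremal)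
qed

theorem unique_minimal_decreasing:
  "unique_on E (\<lambda>f. f \<in> minimal_q_excessive q E E P' \<and> antimono_on E f \<and> f ref = 1)
    (martin_left E P' \<pi> q ref)"
  unfolding conj_assoc[symmetric]
  by (rule unique_on_normalized[OF minimal_decreasing_iff ref])
    (use ref in \<open>auto simp: dual_extremal_def reflected.extremal_ref martin_left_eq\<close>)

lemma killed_at:
  assumes "y \<in> E" "ref' \<in> above S y"
  shows "killed_below S p q y ref ref'"
  by unfold_locales (use assms ref_S E_subset in auto)

context
  fixes y ref' :: int
  assumes y: "y \<in> E" and ref': "ref' \<in> above S y"
begin

interpretation level: killed_below S p q y ref ref'
  by (rule killed_at[OF y ref'])

lemma above_E_eq: "above E y = {x \<in> above S y. x + 1 \<in> above S y}"
  by (auto simp: above_def E_eq)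

lemma killed_martin_kernel_tendsto:
  assumes "x \<in> above S y"
  shows "(martin_kernel (above S y) p \<pi> q ref' x \<longlongrightarrow> martin_right (above S y) p \<pi> q ref' x)
    (to_right_end (above S y))"
proof -
  have pi: "0 < \<pi> z \<and> \<pi> z < top" if "z \<in> above S y" for z
    using \<pi>_pos that by (simp add: above_def)
  show ?thesis
    using level.killed.martin_kernel_tendsto[OF assms ref' pi]
      level.killed.martin_right_eq[OF assms ref' pi] by simp
qed

lemma kappa_tendsto:
  "(kappa_ratio S p \<pi> q ref ref' y \<longlongrightarrow> kappa S p \<pi> q ref ref' y) (to_right_end (above S y))"
  using level.kappa_ratio_tendsto[of \<pi>] level.kappa_eq[of \<pi>] \<pi>_pos by simp

lemma kappa_bounds: "0 < kappa S p \<pi> q ref ref' y" "kappa S p \<pi> q ref ref' y < top"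
  using level.kappa_eq[of \<pi>] \<pi>_pos level.limit_ratio_pos level.limit_ratio_less_top by auto

lemma killed_H_above: "x \<in> above S y \<Longrightarrow> killed_H S p \<pi> q ref ref' y x = level.killed_extremal x"
  by (rule level.killed_H_eq) (auto simp: \<pi>_pos above_def)

lemma martin_right_above: "x \<in> above S y \<Longrightarrow> martin_right S p \<pi> q ref x = H x"
  by (rule martin_right_extremal) (auto simp: above_def)

theorem unique_killed_minimal_increasing:
  "unique_on (above S y)
    (\<lambda>f. f \<in> minimal_q_excessive q (above E y) (above S y) p \<and> mono_on (above S y) f \<and>
      ((\<lambda>x. f x / martin_right S p \<pi> q ref x) \<longlongrightarrow> 1) (to_right_end (above S y)))
    (killed_H S p \<pi> q ref ref' y)"
proof -
  have "minimal_q_excessive q (above E y) (above S y) p = minimal_q_excessive q (above S y) (above S y) p"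
    by (rule level.killed.minimal_absorbing_boundary)
      (use E_subset absorbing in \<open>auto simp: above_def\<close>)
  then have *: "f \<in> minimal_q_excessive q (above E y) (above S y) p \<and> mono_on (above S y) f \<longleftrightarrow>
      (\<exists>c\<in>{0<..<top}. \<forall>x\<in>above S y. f x = c * level.K x)" for f
    using level.killed.minimal_increasing_iff[OF ref', of f] by auto
  show ?thesis
    unfolding conj_assoc[symmetric]
    by (rule level.killed_unique[OF *])
      (use level.limit_ratio_pos level.limit_ratio_less_top killed_H_above martin_right_above in auto)
qed

theorem unique_killed_increasing_harmonic:
  "unique_on (above S y)
    (\<lambda>f. f \<in> q_harmonic q (above E y) (above S y) p \<and> mono_on (above S y) f \<and>
      ((\<lambda>x. f x / martin_right S p \<pi> q ref x) \<longlongrightarrow> 1) (to_right_end (above S y)))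
    (killed_H S p \<pi> q ref ref' y)"
proof -
  have *: "f \<in> q_harmonic q (above E y) (above S y) p \<and> mono_on (above S y) f \<longleftrightarrow>
      (\<exists>c\<in>{..<top}. \<forall>x\<in>above S y. f x = c * level.K x)" for f
    using level.killed.increasing_harmonic_iff[OF ref' above_E_eq, of f] by auto
  show ?thesis
    unfolding conj_assoc[symmetric]
    by (rule level.killed_unique[OF *])
      (use level.limit_ratio_less_top killed_H_above martin_right_above in auto)
qed

text \<open>
  \<open>G x y = \<phi> x y * (g y y / \<pi> y)\<close>; the first factor times \<open>H y\<close> is the difference of \<open>H\<close> and its killed
  version, and the second factor is \<open>H y\<close> times the dual function, up to the constant.
\<close>

theorem potential_kernel_factorization:
  assumes x: "x \<in> E"
  shows "killed_H S p \<pi> q ref ref' y x \<le> martin_right S p \<pi> q ref x"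
    and "potential_kernel S p \<pi> q x y = potential_kernel S p \<pi> q ref ref * martin_left E P' \<pi> q ref y *
      (martin_right S p \<pi> q ref x - killed_H S p \<pi> q ref ref' y x)"
proof -
  have S: "x \<in> S" "y \<in> S" "y + 1 \<in> S" using x y by (auto simp: E_eq)
  have k: "killed_H S p \<pi> q ref ref' y x = level.killed_extremal x"
    by (rule level.killed_H_eq) (use \<pi>_pos S in auto)
  note h = martin_right_extremal[OF S(1)]
  show "killed_H S p \<pi> q ref ref' y x \<le> martin_right S p \<pi> q ref x"
    unfolding h k by (rule level.killed_extremal_le[OF S(1)])
  have "H x - level.killed_extremal x = \<phi> x y * H y"
    by (rule level.full_minus_killed) (use absorbing S in \<open>auto simp: E_eq\<close>)
  then have "potential_kernel S p \<pi> q ref ref * martin_left E P' \<pi> q ref y *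
      (martin_right S p \<pi> q ref x - killed_H S p \<pi> q ref ref' y x)
    = \<phi> x y * (potential_kernel S p \<pi> q ref ref * dual_extremal y * H y)"
    unfolding h k by (simp add: martin_left_eq[OF y] mult_ac)
  also have "\<dots> = potential_kernel S p \<pi> q x y"
    unfolding diagonal_factorization[OF y]
    unfolding potential_kernel_eq_green green_eq_hitting[OF S(2), of x]
    by (simp add: ennreal_times_divide)
  finally show "potential_kernel S p \<pi> q x y = potential_kernel S p \<pi> q ref ref *
      martin_left E P' \<pi> q ref y * (martin_right S p \<pi> q ref x - killed_H S p \<pi> q ref ref' y x)" by simp
qed

end

end

section \<open>Intervals of integers with extended endpoints\<close>

lemma skip_free_chain_kernel:
  assumes "skip_free_chain l r E p" "0 < q" "q < 1"
  shows "skip_free_kernel (with_right_end E r) p q"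
proof
  let ?S = "with_right_end E r"
  note defs = assms(1)[unfolded skip_free_chain_def Let_def]
  have inner: "z \<in> E" if "l < Fin z" "Fin z < r" for z
    using defs that by (auto simp: is_interval_between_def)
  have ends: "l \<le> Fin z \<and> Fin z \<le> r" if "z \<in> E" for z
    using defs that by (auto simp: is_interval_between_def)
  have le_r: "Fin z \<le> r" if "z \<in> ?S" for z
    using that ends by (auto simp: with_right_end_def)
  show "z \<in> ?S" if "x \<in> ?S" "y \<in> ?S" "x \<le> z" "z \<le> y" for x y z
  proof (cases "z = x \<or> z = y")
    case False
    then have lt: "x < z" "z < y" using that by auto
    have "Fin z < r"
      using lt le_r[OF that(2)] by (metis less_extended_simps(1) order.strict_trans2)
    moreover have "x \<in> E"
    proof (rule ccontr)
      assume "x \<notin> E"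
      then have "Fin x = r" using that(1) by (auto simp: with_right_end_def)
      then show False using le_r[OF that(2)] lt by auto
    qed
    then have "l < Fin z"
      using lt ends[of x] by (metis less_extended_simps(1) order.strict_trans1)
    ultimately show ?thesis using inner by (simp add: with_right_end_def)
  qed (use that in auto)
  show "p x y = 0" if "x \<in> ?S" "y \<in> ?S" "x + 1 < y" for x y
  proof -
    have k: "2 \<le> y - x" using that(3) by simp
    have "\<forall>x\<in>?S. \<forall>k\<ge>2. x + k \<in> ?S \<longrightarrow> p x (x + k) = 0" using defs by blast
    then have "x + (y - x) \<in> ?S \<longrightarrow> p x (x + (y - x)) = 0"
      using that(1) k by blast
    then show ?thesis using that by simp
  qed
qed (use assms in \<open>auto simp: skip_free_chain_def Let_def\<close>)

text \<open>
  In the class \<open>\<M>\<^sub>\<infinity>\<close> every state of \<open>E\<close> lies strictly below \<open>r\<close>, so its upper neighbour is in \<open>E\<close> or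
  is the absorbing end \<open>r\<close> itself, above which there is no state.
\<close>

lemma skip_free_chain_inf_states:
  assumes "skip_free_chain_inf l r E p"
  defines "S \<equiv> with_right_end E r"
  shows "E = {x \<in> S. x + 1 \<in> S}" "\<And>x. x \<in> S \<Longrightarrow> x \<notin> E \<Longrightarrow> p x x = 1"
proof -
  have int: "is_interval_between l r E" and not_r: "\<And>x. x \<in> E \<Longrightarrow> Fin x \<noteq> r"
    using assms by (auto simp: skip_free_chain_inf_def skip_free_chain_def Let_def)
  have le_r: "Fin x \<le> r" if "x \<in> S" for x
    using that int by (auto simp: S_def with_right_end_def is_interval_between_def)
  have "x + 1 \<in> S" if "x \<in> E" for x
  proof -
    have lt: "Fin x < r" and l: "l \<le> Fin x"
      using int that not_r by (auto simp: is_interval_between_def order.strict_iff_order)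
    have "l < Fin (x + 1)"
      using l by (rule order.strict_trans1) simp
    moreover have "Fin (x + 1) \<le> r"
      using lt by (cases r) auto
    ultimately show ?thesis
      using int by (auto simp: S_def with_right_end_def is_interval_between_def order.order_iff_strict)
  qed
  moreover have "x \<in> E" if "x \<in> S" "x + 1 \<in> S" for x
    using that le_r[OF that(2)] by (auto simp: S_def with_right_end_def)
  ultimately show "E = {x \<in> S. x + 1 \<in> S}"
    by (auto simp: S_def with_right_end_def)
  show "p x x = 1" if "x \<in> S" "x \<notin> E" for x
    using that assms by (auto simp: S_def with_right_end_def skip_free_chain_inf_def skip_free_chain_def Let_def)
qed

theorem theorem3p1:
  fixes l r :: "int extended"
    and E :: "int set"
    and p :: "int \<Rightarrow> int \<Rightarrow> ennreal"
    and \<pi> :: "int \<Rightarrow> ennreal"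
    and q :: ennreal
    and ref :: int
    and ref_above :: "int \<Rightarrow> int"
  assumes chain: "skip_free_chain l r E p"
    and measure: "reference_measure r E p \<pi>"
    and q: "0 < q" "q < 1"
    and ref: "ref \<in> E" "Fin (ref + 1) < r"
    and ref_above: "\<forall>y\<in>E. Fin y < r \<longrightarrow> ref_above y \<in> above (with_right_end E r) y"
  shows
    "let S = with_right_end E r;
         G = potential_kernel S p \<pi> q;
         H = martin_right S p \<pi> q ref;
         P' = dual_matrix p \<pi>;
         H' = martin_left E P' \<pi> q ref;
         \<kappa> = (\<lambda>y. kappa S p \<pi> q ref (ref_above y) y);
         HH = (\<lambda>y. killed_H S p \<pi> q ref (ref_above y) y);
         C = G ref ref
     in
       (skip_free_chain_inf l r E p \<longrightarrow>
          (\<comment> \<open>(1)\<close>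
           (\<forall>x\<in>S. (martin_kernel S p \<pi> q ref x \<longlongrightarrow> H x) (to_right_end S)) \<and>
           (\<forall>x\<in>E. (martin_kernel E P' \<pi> q ref x \<longlongrightarrow> H' x) (to_left_end E)) \<and>
           unique_on S (\<lambda>f. f \<in> minimal_q_excessive q E S p \<and> mono_on S f \<and> f ref = 1) H \<and>
           unique_on E (\<lambda>f. f \<in> minimal_q_excessive q E E P' \<and> antimono_on E f \<and> f ref = 1) H' \<and>
           unique_on S (\<lambda>f. f \<in> q_harmonic q E S p \<and> mono_on S f \<and> f ref = 1) H) \<and>
          (\<comment> \<open>(2)\<close>
           \<forall>y\<in>E. Fin y < r \<longrightarrow>
             (let Ey = above E y; Sy = above S y in
                (\<forall>x\<in>Sy. (martin_kernel Sy p \<pi> q (ref_above y) x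
                   \<longlongrightarrow> martin_right Sy p \<pi> q (ref_above y) x) (to_right_end Sy)) \<and>
                (kappa_ratio S p \<pi> q ref (ref_above y) y \<longlongrightarrow> \<kappa> y) (to_right_end Sy) \<and>
                0 < \<kappa> y \<and> \<kappa> y < top \<and>
                unique_on Sy (\<lambda>f. f \<in> minimal_q_excessive q Ey Sy p \<and> mono_on Sy f \<and>
                  ((\<lambda>x. f x / H x) \<longlongrightarrow> 1) (to_right_end Sy)) (HH y) \<and>
                unique_on Sy (\<lambda>f. f \<in> q_harmonic q Ey Sy p \<and> mono_on Sy f \<and>
                  ((\<lambda>x. f x / H x) \<longlongrightarrow> 1) (to_right_end Sy)) (HH y))) \<and>
          (\<comment> \<open>(3); subtraction on \<^typ>\<open>ennreal\<close> is truncated, hence the first conjunct\<close>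
           0 < C \<and> C < top \<and>
           (\<forall>x\<in>E. \<forall>y\<in>E. HH y x \<le> H x \<and> G x y = C * H' y * (H x - HH y x)))) \<and>
       (skip_free_chain l r E p \<and> \<not> skip_free_chain_inf l r E p \<longrightarrow>
          H \<in> q_potential q E S p \<and> (\<forall>a. Fin a = r \<longrightarrow> H a < top))"
  unfolding Let_def
proof (intro conjI impI)
  let ?S = "with_right_end E r"
  note S_positive = measure[unfolded reference_measure_def]
  have pi: "0 < \<pi> x \<and> \<pi> x < top" if "x \<in> ?S" for x
    using S_positive that by auto
  have pi_exc: "(\<integral>\<^sup>+ x. \<pi> x * p x y \<partial>count_space E) \<le> \<pi> y" if "y \<in> E" for y
    using S_positive that by auto
  interpret skip_free_kernel ?S p q
    by (rule skip_free_chain_kernel[OF chain q])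
  {
    assume inf: "skip_free_chain_inf l r E p"
    interpret chain_with_dual ?S p q E \<pi> ref
      using skip_free_chain_inf_states[OF inf] pi pi_exc ref by unfold_locales auto
    have ra: "ref_above y \<in> above ?S y" if "y \<in> E" for y
    proof -
      have "Fin y \<le> r"
        using that chain by (auto simp: skip_free_chain_def Let_def is_interval_between_def)
      moreover have "Fin y \<noteq> r"
        using that inf by (auto simp: skip_free_chain_inf_def)
      ultimately show ?thesis
        using ref_above that by (simp add: order.strict_iff_order)
    qed
    show "\<forall>x\<in>?S. (martin_kernel ?S p \<pi> q ref x \<longlongrightarrow> martin_right ?S p \<pi> q ref x) (to_right_end ?S)"
      using martin_kernel_tendsto ref_S pi martin_right_extremal by simp
    show "\<forall>x\<in>E. (martin_kernel E (dual_matrix p \<pi>) \<pi> q ref x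
        \<longlongrightarrow> martin_left E (dual_matrix p \<pi>) \<pi> q ref x) (to_left_end E)"
      using dual_martin_kernel_tendsto martin_left_eq by simp
    show "unique_on ?S (\<lambda>f. f \<in> minimal_q_excessive q E ?S p \<and> mono_on ?S f \<and> f ref = 1)
        (martin_right ?S p \<pi> q ref)"
      by (rule unique_minimal_increasing)
    show "unique_on E (\<lambda>f. f \<in> minimal_q_excessive q E E (dual_matrix p \<pi>) \<and> antimono_on E f \<and> f ref = 1)
        (martin_left E (dual_matrix p \<pi>) \<pi> q ref)"
      by (rule unique_minimal_decreasing)
    show "unique_on ?S (\<lambda>f. f \<in> q_harmonic q E ?S p \<and> mono_on ?S f \<and> f ref = 1)
        (martin_right ?S p \<pi> q ref)"
      by (rule unique_increasing_harmonic)
    show "0 < potential_kernel ?S p \<pi> q ref ref" "potential_kernel ?S p \<pi> q ref ref < top"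
      by (fact potential_kernel_ref_bounds)+
    show "\<forall>y\<in>E. Fin y < r \<longrightarrow>
        (\<forall>x\<in>above ?S y. (martin_kernel (above ?S y) p \<pi> q (ref_above y) x \<longlongrightarrow>
           martin_right (above ?S y) p \<pi> q (ref_above y) x) (to_right_end (above ?S y))) \<and>
        (kappa_ratio ?S p \<pi> q ref (ref_above y) y \<longlongrightarrow> kappa ?S p \<pi> q ref (ref_above y) y)
          (to_right_end (above ?S y)) \<and>
        0 < kappa ?S p \<pi> q ref (ref_above y) y \<and> kappa ?S p \<pi> q ref (ref_above y) y < top \<and>
        unique_on (above ?S y) (\<lambda>f. f \<in> minimal_q_excessive q (above E y) (above ?S y) p \<and>
          mono_on (above ?S y) f \<and>
          ((\<lambda>x. f x / martin_right ?S p \<pi> q ref x) \<longlongrightarrow> 1) (to_right_end (above ?S y)))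
          (killed_H ?S p \<pi> q ref (ref_above y) y) \<and>
        unique_on (above ?S y) (\<lambda>f. f \<in> q_harmonic q (above E y) (above ?S y) p \<and>
          mono_on (above ?S y) f \<and>
          ((\<lambda>x. f x / martin_right ?S p \<pi> q ref x) \<longlongrightarrow> 1) (to_right_end (above ?S y)))
          (killed_H ?S p \<pi> q ref (ref_above y) y)"
      using ra by (intro ballI impI conjI killed_martin_kernel_tendsto kappa_tendsto kappa_bounds
          unique_killed_minimal_increasing unique_killed_increasing_harmonic) auto
    show "\<forall>x\<in>E. \<forall>y\<in>E. killed_H ?S p \<pi> q ref (ref_above y) y x \<le> martin_right ?S p \<pi> q ref x \<and>
        potential_kernel ?S p \<pi> q x y = potential_kernel ?S p \<pi> q ref ref *
          martin_left E (dual_matrix p \<pi>) \<pi> q ref y *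
          (martin_right ?S p \<pi> q ref x - killed_H ?S p \<pi> q ref (ref_above y) y x)"
      using ra by (intro ballI conjI potential_kernel_factorization) auto
  next
    assume "skip_free_chain l r E p \<and> \<not> skip_free_chain_inf l r E p"
    then obtain a where a: "Fin a = r" "a \<in> E"
      by (auto simp: skip_free_chain_inf_def)
    then have S: "?S = E" by (auto simp: with_right_end_def)
    let ?H = "martin_right ?S p \<pi> q ref"
    have in_S: "ref \<in> ?S" "a \<in> ?S" using a ref S by auto
    have le_a: "x \<le> a" if "x \<in> ?S" for x
      using that chain a unfolding S
      by (auto simp: skip_free_chain_def Let_def is_interval_between_def)
    have H: "?H x = extremal q ?S p ref x" if "x \<in> ?S" for x
      using that in_S pi by (intro martin_right_eq) auto
    have fin: "?H x < top" if "x \<in> ?S" for x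
      using extremal_neq[OF that in_S(1)] by (simp add: H[OF that] less_top[symmetric])
    have "A ?H x = A (extremal q ?S p ref) x" for x
      by (rule discounted_op_cong) (simp add: H)
    then have "?H \<in> q_excessive q ?S ?S p"
      using extremal_excessive in_S fin by (simp add: q_excessive_def H)
    moreover have "?H x \<le> ?H a" if "x \<in> ?S" for x
      using extremal_mono[OF that in_S le_a[OF that]] that in_S by (simp add: H)
    ultimately have "?H \<in> q_potential q ?S ?S p"
      using fin[OF in_S(2)] by (intro bounded_excessive_is_potential[where M = "?H a"])
    then show "?H \<in> q_potential q E ?S p" by (simp add: S)
    show "\<forall>a'. Fin a' = r \<longrightarrow> ?H a' < top" using fin a S by auto
  }
qed

end
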